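(* Consider, with fixed reference vectors $y_{ij}=y_{ji}\in S^{n-1}$, $(i,j)\in\mathcal{E}$, the dynamics on $(SO(n))^k$ $$\tfrac{d}{dt}Q_i=Q_i\sum_{\{j:(i,j)\in\mathcal{E}\}}\mathrm{skew}(Q_i^TM_{ij}Q_j),\qquad i=1,\ldots,k.$$ (a) If $\mathrm{rank}\,L^g=n(k-1)$, then $C_o=C_s$ and the set $C_o=C_s$ is locally exponentially stable. (b) Let $V\in\mathbb{R}^{n^2k\times kn(n-1)/2}$ be a matrix whose column vectors are an orthonormal basis of $\mathrm{vec}(\mathfrak{so}(n)^k)\subseteq\mathbb{R}^{n^2k}$. Then $C_s$ is locally exponentially stable if and only if $\mathrm{rank}\big(V^T(I_n\otimes L^g)V\big)=(k-1)\tfrac{n(n-1)}{2}$.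
   Context: $\mathcal{G}(\mathcal{V},\mathcal{E})$ is an undirected finite graph without self-loops, $\mathcal{V}=\{1,\ldots,k\}$, $k>2$, with adjacency matrix $(a_{ij})$: $a_{ij}=1$ if $(i,j)\in\mathcal{E}$, $a_{ij}=0$ otherwise; $n\ge2$. $\mathrm{skew}(X)=\tfrac12(X-X^T)$; $M_{ij}=y_{ij}y_{ij}^T$; $\otimes$ is the Kronecker product; $\mathfrak{so}(n)$ is the space of skew-symmetric $n\times n$ real matrices. $C_s=\{(Q_1,\ldots,Q_k)\in(SO(n))^k: Q_1=\cdots=Q_k\}$ and $C_o=\{(Q_1,\ldots,Q_k)\in(SO(n))^k: Q_i^Ty_{ij}=Q_j^Ty_{ij}\ \forall(i,j)\in\mathcal{E}\}$. The extended Laplacian $L^g=(L^g_{ij})\in\mathbb{R}^{kn\times kn}$ has $n\times n$ blocks $L^g_{ij}=-a_{ij}M_{ij}$ for $i\ne j$ and $L^g_{ii}=\sum_{j=1}^k a_{ij}M_{ij}$. For a matrix $X$, $\mathrm{vec}(X)$ is the vector obtained by stacking its columns. For a set $S\subset(\mathbb{R}^{n\times n})^k$, $\mathrm{vec}(S)=\{\mathrm{vec}((X_1^T,\ldots,X_k^T)^T):(X_1,\ldots,X_k)\in S\}\subset\mathbb{R}^{kn^2}$, i.e. $X_1,\ldots,X_k$ are first stacked vertically into a $kn\times n$ matrix, which is then vectorized. *)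

theory Defs
  imports "HOL-Analysis.Analysis"
begin

definition SO :: "(real^'n^'n) set" where
  "SO = {Q. rotation_matrix Q}"

definition SO_pow :: "(real^'n^'n^'k) set" where
  "SO_pow = {Q. \<forall>i. Q $ i \<in> SO}"

definition so :: "(real^'n^'n) set" where
  "so = {X. transpose X = - X}"

definition so_pow :: "(real^'n^'n^'k) set" where
  "so_pow = {X. \<forall>i. X $ i \<in> so}"

definition skew :: "real^'n^'n \<Rightarrow> real^'n^'n" where
  "skew X = (1/2) *\<^sub>R (X - transpose X)"

definition outer :: "real^'n \<Rightarrow> real^'n^'n" where
  "outer v = (\<chi> r c. v $ r * v $ c)"

definition adj :: "('k \<times> 'k) set \<Rightarrow> 'k \<Rightarrow> 'k \<Rightarrow> real" where
  "adj E i j = (if (i, j) \<in> E then 1 else 0)"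

definition dynamics ::
  "('k::finite \<times> 'k) set \<Rightarrow> ('k \<Rightarrow> 'k \<Rightarrow> real^'n) \<Rightarrow> real^'n^'n^'k \<Rightarrow> real^'n^'n^'k" where
  "dynamics E y Q =
     (\<chi> i. Q $ i ** (\<Sum>j\<in>{j. (i, j) \<in> E}. skew (transpose (Q $ i) ** outer (y i j) ** Q $ j)))"

definition C_s :: "(real^'n^'n^'k) set" where
  "C_s = {Q \<in> SO_pow. \<forall>i j. Q $ i = Q $ j}"

definition C_o :: "('k \<times> 'k) set \<Rightarrow> ('k \<Rightarrow> 'k \<Rightarrow> real^'n) \<Rightarrow> (real^'n^'n^'k) set" where
  "C_o E y = {Q \<in> SO_pow.
     \<forall>(i, j)\<in>E. transpose (Q $ i) *v y i j = transpose (Q $ j) *v y i j}"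

(* Rows and columns are indexed by pairs (block index, index within the block). *)
definition ext_laplacian ::
  "('k::finite \<times> 'k) set \<Rightarrow> ('k \<Rightarrow> 'k \<Rightarrow> real^'n) \<Rightarrow> real^('k \<times> 'n)^('k \<times> 'n)" where
  "ext_laplacian E y = (\<chi> p q.
     (if fst p = fst q then \<Sum>l\<in>UNIV. adj E (fst p) l *\<^sub>R outer (y (fst p) l)
      else - (adj E (fst p) (fst q) *\<^sub>R outer (y (fst p) (fst q)))) $ snd p $ snd q)"

definition kronecker :: "real^'b^'a \<Rightarrow> real^'d^'c \<Rightarrow> real^('b \<times> 'd)^('a \<times> 'c)" where
  "kronecker A B = (\<chi> p q. A $ fst p $ fst q * B $ snd p $ snd q)"

(* Column-stacking: the column index is the block index, so that
   vectorize (L ** X) = kronecker (mat 1) L *v vectorize X. *)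
definition vectorize :: "real^'n^'m \<Rightarrow> real^('n \<times> 'm)" where
  "vectorize X = (\<chi> p. X $ snd p $ fst p)"

definition vstack :: "real^'n^'n^'k \<Rightarrow> real^'n^('k \<times> 'n)" where
  "vstack X = (\<chi> p. X $ fst p $ snd p)"

definition vec_set :: "(real^'n^'n^'k) set \<Rightarrow> (real^('n \<times> 'k \<times> 'n)) set" where
  "vec_set S = (\<lambda>X. vectorize (vstack X)) ` S"

(* The columns, counted with their indices, are orthonormal and span the subspace S. *)
definition orthonormal_basis_columns :: "real^'d^'m \<Rightarrow> (real^'m) set \<Rightarrow> bool" where
  "orthonormal_basis_columns V S \<longleftrightarrow>
     (\<forall>a b. column a V \<bullet> column b V = (if a = b then 1 else 0)) \<and>
     span (columns V) = S"

definition is_solution ::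
  "('a::real_normed_vector \<Rightarrow> 'a) \<Rightarrow> 'a set \<Rightarrow> (real \<Rightarrow> 'a) \<Rightarrow> bool" where
  "is_solution f M Q \<longleftrightarrow>
     (\<forall>t\<ge>0. Q t \<in> M \<and> (Q has_vector_derivative f (Q t)) (at t within {0..}))"

(* Distances are taken in the ambient norm, which on tuples of matrices is the Frobenius norm. *)
definition locally_exponentially_stable ::
  "('a::real_normed_vector \<Rightarrow> 'a) \<Rightarrow> 'a set \<Rightarrow> 'a set \<Rightarrow> bool" where
  "locally_exponentially_stable f M C \<longleftrightarrow>
     (\<exists>\<delta>>0. \<exists>\<alpha>>0. \<exists>\<beta>>0. \<forall>Q. is_solution f M Q \<and> infdist (Q 0) C < \<delta> \<longrightarrow>
        (\<forall>t\<ge>0. infdist (Q t) C \<le> \<alpha> * exp (- \<beta> * t) * infdist (Q 0) C))"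

end

theory Submission
  imports Defs
begin

text \<open>
  With \<open>lap Q = (\<Sum>j. M\<^sub>i\<^sub>j (Q\<^sub>i - Q\<^sub>j))\<^sub>i\<close> the dynamics is minus the gradient of \<open>e / 2\<close>, \<open>e Q = \<langle>Q, lap Q\<rangle>\<close>, on
  \<open>SO(n)\<^sup>k\<close>: \<open>e\<close> decays at rate \<open>2 |Q'|\<^sup>2\<close>.  Near the consensus set the Hessian of \<open>e\<close> is \<open>\<langle>W, lap W\<rangle>\<close> on
  skew-symmetric tuples \<open>W\<close>.  If its kernel consists of consensus tuples only, then writing \<open>Q\<close> relative to
  the nearest consensus state shows that both \<open>e\<close> and \<open>|Q'|\<^sup>2\<close> are comparable to the squared distance,
  hence exponential decay.  If the kernel contains a further direction, the solutions starting along it at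
  distance \<open>\<epsilon>\<close> have energy \<open>O(\<epsilon>\<^sup>4)\<close> and so move by only \<open>O(\<epsilon>\<^sup>2)\<close> in fixed time, which excludes exponential
  decay.  The two rank conditions are statements about this kernel by rank-nullity.
\<close>

subsection \<open>Global solutions of Lipschitz differential equations\<close>

text \<open>The energy is a quadratic form on all matrix tuples and \<open>lap\<close> annihilates
  consensus tuples, so expanding it at a consensus state leaves no Taylor remainder. Errors come
  only from the curvature of \<open>SO\<close>: if \<open>mat 1 + H\<close> is a rotation, the
  symmetric part of \<open>H\<close> is quadratic in \<open>H\<close>. Every local estimate is thus
  a perturbation of one form on skew tuples. Equilibria fill the continuum \<open>C_s\<close>, so
  this form always degenerates along consensus directions. Optimality of the nearest consensus state
  makes the skew parts of the deviation sum to zero, which removes exactly these directions.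
  Stability quantifies over solutions, so drawing conclusions from it requires producing some: hence
  the existence theorem, and the proof that its solutions stay in \<open>SO_pow\<close>. Cayley
  curves play the part of the exponential map, both as competitors for the nearest state and as
  starting points; one algebraic equation yields their expansion with constants uniform in the skew
  matrix.\<close>

lemma at_within_Ici_eq_Icc:
  fixes u :: real
  assumes "0 \<le> u"
  shows "at u within {0..} = at u within {0..u + 1}"
  by (rule at_within_nhd[of u "{..<u + 1}"]) auto

lemma integral_Ici_has_vector_derivative:
  fixes h :: "real \<Rightarrow> 'a::banach"
  assumes "continuous_on {0..} h" "0 \<le> u"
  shows "((\<lambda>t. integral {0..t} h) has_vector_derivative h u) (at u within {0..})"
  unfolding at_within_Ici_eq_Icc[OF assms(2)]
  by (rule integral_has_vector_derivative) (use assms in \<open>auto intro: continuous_on_subset\<close>)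

text \<open>The gain \<open>1 / c\<close> is the point: under the weight, integration divides the
  bound by \<open>c\<close>, so a strong weight beats any Lipschitz constant.\<close>

lemma exp_weighted_integral_bound:
  fixes h :: "real \<Rightarrow> 'a::banach"
  assumes c: "0 < c" and cont: "continuous_on {0..} h" and t: "0 \<le> t"
    and bnd: "\<And>s. 0 \<le> s \<Longrightarrow> norm (h s) \<le> K * exp (c * s)"
  shows "exp (- (c * t)) * norm (integral {0..t} h) \<le> K / c"
proof -
  have K: "0 \<le> K" using order_trans[OF norm_ge_zero bnd[of 0]] by simp
  have I: "((\<lambda>s. K * exp (c * s)) has_integral (K / c * exp (c * t) - K / c * exp (c * 0))) {0..t}"
    using c t by (intro fundamental_theorem_of_calculus)
      (auto intro!: derivative_eq_intros simp flip: has_real_derivative_iff_has_vector_derivative)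
  have "norm (integral {0..t} h) \<le> K / c * exp (c * t) - K / c * exp (c * 0)"
    using cont by (intro integral_norm_bound_integral[OF _ has_integral_integrable[OF I], unfolded integral_unique[OF I]])
      (auto intro!: integrable_continuous_real bnd intro: continuous_on_subset)
  also have "\<dots> \<le> K / c * exp (c * t)" using K c by simp
  finally have "exp (- (c * t)) * norm (integral {0..t} h) \<le> exp (- (c * t)) * (K / c * exp (c * t))"
    by (intro mult_left_mono) auto
  also have "\<dots> = K / c" by (simp add: exp_minus field_simps)
  finally show ?thesis .
qed

text \<open>Picard iteration on \<open>[0, \<infinity>)\<close> in one step: for the weighted unknown
  \<open>w t = exp (- 2 M t) x t\<close> the integral operator is a contraction of bounded continuous functions.\<close>

lemma lipschitz_ode_solution:
  fixes G :: "'a::banach \<Rightarrow> 'a"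
  assumes "L-lipschitz_on UNIV G"
  obtains x where "x 0 = x0"
    "\<And>t. 0 \<le> t \<Longrightarrow> (x has_vector_derivative G (x t)) (at t within {0..})"
proof -
  \<comment> \<open>The 1 keeps \<open>M\<close> positive when \<open>L = 0\<close>, since
    \<open>2 * M\<close> becomes a divisor. The weight \<open>2 * M\<close> against the Lipschitz
    constant \<open>M\<close> gives the contraction factor 1/2.\<close>
  define M where "M = L + 1"
  have M: "0 < M" using lipschitz_on_nonneg[OF assms] by (simp add: M_def)
  have lip: "norm (G a - G b) \<le> M * norm (a - b)" for a b
  proof -
    have "norm (G a - G b) \<le> L * norm (a - b)"
      using lipschitz_onD[OF assms, of a b] by (simp add: dist_norm)
    also have "\<dots> \<le> M * norm (a - b)" by (intro mult_right_mono) (auto simp: M_def)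
    finally show ?thesis .
  qed
  have contG: "continuous_on UNIV G" using assms lipschitz_on_continuous_on by blast
  define h where "h w s = G (exp (2 * M * s) *\<^sub>R apply_bcontfun w s)" for w :: "real \<Rightarrow>\<^sub>C 'a" and s
  have conth: "continuous_on S (h w)" for S w
    unfolding h_def by (intro continuous_on_compose2[OF contG] continuous_intros) auto
  define I where "I w t = integral {0..t} (h w)" for w t
  have dI: "(I w has_vector_derivative h w u) (at u within {0..})" if "0 \<le> u" for w u
    unfolding I_def by (rule integral_Ici_has_vector_derivative[OF conth that])
  have contI: "continuous_on {0..} (I w)" for w
    using dI by (auto simp: continuous_on_eq_continuous_within intro: has_vector_derivative_continuous)
  \<comment> \<open>\<open>max 0 t\<close> freezes the function on the negative half-line, because
    bounded continuous functions live on all reals.\<close>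
  define F where "F w t = exp (- (2 * M * max 0 t)) *\<^sub>R (x0 + I w (max 0 t))" for w t
  have contF: "continuous_on UNIV (F w)" for w
    unfolding F_def by (intro continuous_intros continuous_on_compose2[OF contI]) auto
  have hbnd: "norm (h w s) \<le> (norm (G 0) + M * norm w) * exp (2 * M * s)" if "0 \<le> s" for w s
  proof -
    have "norm (h w s) \<le> norm (G 0) + norm (h w s - G 0)" by norm
    also have "\<dots> \<le> norm (G 0) + M * (exp (2 * M * s) * norm (apply_bcontfun w s))"
      using lip[of "exp (2 * M * s) *\<^sub>R apply_bcontfun w s" 0] by (simp add: h_def)
    also have "\<dots> \<le> norm (G 0) * exp (2 * M * s) + M * (exp (2 * M * s) * norm w)"
      using M that by (intro add_mono mult_left_mono norm_bounded)
        (auto simp: mult_le_cancel_left1)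
    finally show ?thesis by (simp add: algebra_simps)
  qed
  have Fbnd: "norm (F w t) \<le> norm x0 + (norm (G 0) + M * norm w) / (2 * M)" for w t
  proof -
    let ?t = "max 0 t"
    have "norm (F w t) \<le> exp (- (2 * M * ?t)) * (norm x0 + norm (I w ?t))"
      unfolding F_def by (simp add: norm_triangle_ineq)
    also have "\<dots> = exp (- (2 * M * ?t)) * norm x0 + exp (- (2 * M * ?t)) * norm (I w ?t)"
      by (simp add: algebra_simps)
    also have "\<dots> \<le> 1 * norm x0 + (norm (G 0) + M * norm w) / (2 * M)"
      unfolding I_def
      by (intro add_mono mult_right_mono exp_weighted_integral_bound conth hbnd) (use M in auto)
    finally show ?thesis by simp
  qed
  define T where "T w = Bcontfun (F w)" for w
  have T: "apply_bcontfun (T w) = F w" for w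
    unfolding T_def by (intro Bcontfun_inverse bcontfun_normI[OF contF Fbnd])
  have "\<exists>!w. T w = w"
  proof (rule banach_fix_type[of "1/2"])
    show "\<forall>w v. dist (T w) (T v) \<le> 1 / 2 * dist w v"
    proof (intro allI)
      fix w v
      show "dist (T w) (T v) \<le> 1 / 2 * dist w v"
      proof (rule dist_bound)
        fix t :: real
        let ?t = "max 0 t"
        have "integral {0..?t} (\<lambda>s. h w s - h v s) = I w ?t - I v ?t"
          unfolding I_def by (intro integral_diff integrable_continuous_real conth)
        then have "dist (F w t) (F v t) = exp (- (2 * M * ?t)) * norm (integral {0..?t} (\<lambda>s. h w s - h v s))"
          unfolding F_def dist_norm by (simp flip: scaleR_diff_right)
        also have "\<dots> \<le> M * dist w v / (2 * M)"
        proof (rule exp_weighted_integral_bound)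
          fix s :: real assume "0 \<le> s"
          have "norm (h w s - h v s) \<le> M * norm (exp (2 * M * s) *\<^sub>R (apply_bcontfun w s - apply_bcontfun v s))"
            unfolding h_def scaleR_diff_right by (rule lip)
          also have "\<dots> = M * (exp (2 * M * s) * dist (apply_bcontfun w s) (apply_bcontfun v s))"
            by (simp add: dist_norm)
          also have "\<dots> \<le> M * (exp (2 * M * s) * dist w v)"
            using M by (intro mult_left_mono dist_bounded) auto
          finally show "norm (h w s - h v s) \<le> M * dist w v * exp (2 * M * s)" by (simp add: algebra_simps)
        qed (use M in \<open>auto intro!: continuous_intros conth\<close>)
        finally show "dist (apply_bcontfun (T w) t) (apply_bcontfun (T v) t) \<le> 1 / 2 * dist w v"
          using M by (simp add: T)
      qed
    qed
  qed auto
  then obtain w where w: "T w = w" by blast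
  define x where "x t = x0 + I w t" for t
  have xw: "exp (2 * M * t) *\<^sub>R apply_bcontfun w t = x t" if "0 \<le> t" for t
    using fun_cong[OF T[of w], of t] that w by (simp add: F_def x_def exp_minus)
  have "(x has_vector_derivative G (x t)) (at t within {0..})" if "0 \<le> t" for t
    using dI[OF that, of w] xw[OF that] unfolding x_def h_def
    by (auto intro!: derivative_eq_intros)
  moreover have "x 0 = x0" by (simp add: x_def I_def)
  ultimately show ?thesis using that by blast
qed

subsection \<open>Rotations and skew-symmetric matrices\<close>

lemma bounded_bilinear_matrix_mult:
  "bounded_bilinear ((**) :: real^'m^'n \<Rightarrow> real^'p^'m \<Rightarrow> real^'p^'n)"
  by (auto simp: bilinear_conv_bounded_bilinear[symmetric] bilinear_def linear_iff matrix_matrix_mult_def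
      vec_eq_iff sum.distrib algebra_simps sum_distrib_left)

lemmas matrix_mult_linear =
  bounded_bilinear.add_left[OF bounded_bilinear_matrix_mult]
  bounded_bilinear.add_right[OF bounded_bilinear_matrix_mult]
  bounded_bilinear.diff_left[OF bounded_bilinear_matrix_mult]
  bounded_bilinear.diff_right[OF bounded_bilinear_matrix_mult]
  bounded_bilinear.minus_left[OF bounded_bilinear_matrix_mult]
  bounded_bilinear.minus_right[OF bounded_bilinear_matrix_mult]
  bounded_bilinear.scaleR_left[OF bounded_bilinear_matrix_mult]
  bounded_bilinear.scaleR_right[OF bounded_bilinear_matrix_mult]
  bounded_bilinear.sum_left[OF bounded_bilinear_matrix_mult]
  bounded_bilinear.sum_right[OF bounded_bilinear_matrix_mult]
  bounded_bilinear.zero_left[OF bounded_bilinear_matrix_mult]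
  bounded_bilinear.zero_right[OF bounded_bilinear_matrix_mult]

lemma bounded_linear_transpose: "bounded_linear (transpose :: real^'n^'m \<Rightarrow> real^'m^'n)"
  by (auto simp: linear_conv_bounded_linear[symmetric] linear_iff transpose_def vec_eq_iff)

lemmas transpose_linear =
  linear_add[OF bounded_linear.linear[OF bounded_linear_transpose]]
  linear_diff[OF bounded_linear.linear[OF bounded_linear_transpose]]
  linear_neg[OF bounded_linear.linear[OF bounded_linear_transpose]]
  linear_cmul[OF bounded_linear.linear[OF bounded_linear_transpose]]
  linear_sum[OF bounded_linear.linear[OF bounded_linear_transpose]]
  linear_0[OF bounded_linear.linear[OF bounded_linear_transpose]]

lemma bounded_linear_skew: "bounded_linear (skew :: real^'n^'n \<Rightarrow> real^'n^'n)"
  unfolding skew_def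
  by (intro bounded_linear_intros bounded_linear_transpose)

section \<open>Frobenius inner product and norm\<close>

lemma inner_transpose: "transpose X \<bullet> transpose Y = X \<bullet> Y" for X Y :: "real^'n^'m"
  unfolding inner_vec_def transpose_def by simp (rule sum.swap)

lemma norm_transpose: "norm (transpose X) = norm X" for X :: "real^'n^'m"
  by (simp add: norm_eq_sqrt_inner inner_transpose)

lemma inner_matrix_mult_left: "(A ** X) \<bullet> Y = X \<bullet> (transpose A ** Y)"
  for A :: "real^'m^'n" and X :: "real^'p^'m"
proof -
  have "(A ** X) \<bullet> Y = (\<Sum>i\<in>UNIV. \<Sum>j\<in>UNIV. \<Sum>k\<in>UNIV. A $ i $ k * X $ k $ j * Y $ i $ j)"
    by (simp add: inner_vec_def matrix_matrix_mult_def sum_distrib_right)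
  also have "\<dots> = (\<Sum>i\<in>UNIV. \<Sum>k\<in>UNIV. \<Sum>j\<in>UNIV. A $ i $ k * X $ k $ j * Y $ i $ j)"
    by (intro sum.cong refl sum.swap)
  also have "\<dots> = (\<Sum>k\<in>UNIV. \<Sum>i\<in>UNIV. \<Sum>j\<in>UNIV. A $ i $ k * X $ k $ j * Y $ i $ j)"
    by (rule sum.swap)
  also have "\<dots> = (\<Sum>k\<in>UNIV. \<Sum>j\<in>UNIV. \<Sum>i\<in>UNIV. A $ i $ k * X $ k $ j * Y $ i $ j)"
    by (intro sum.cong refl sum.swap)
  also have "\<dots> = X \<bullet> (transpose A ** Y)"
    by (simp add: inner_vec_def matrix_matrix_mult_def transpose_def sum_distrib_left mult_ac)
  finally show ?thesis .
qed

lemma inner_matrix_mult_right: "(X ** A) \<bullet> Y = X \<bullet> (Y ** transpose A)"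
  for A :: "real^'p^'m" and X :: "real^'m^'n"
  using inner_matrix_mult_left[of "transpose A" "transpose X" "transpose Y"]
  by (simp add: inner_transpose flip: matrix_transpose_mul)
    (metis inner_transpose matrix_transpose_mul transpose_transpose)

lemma power2_norm_vec: "(norm x)\<^sup>2 = (\<Sum>i\<in>UNIV. (norm (x $ i))\<^sup>2)" for x :: "'a::real_inner^'n"
  by (simp add: power2_norm_eq_inner inner_vec_def)

lemma norm_matrix_mult_le: "norm (A ** B) \<le> norm A * norm B"
  for A :: "real^'m^'n" and B :: "real^'p^'m"
proof (rule power2_le_imp_le)
  have entry: "(A ** B) $ i $ j = A $ i \<bullet> transpose B $ j" for i j
    by (simp add: matrix_matrix_mult_def inner_vec_def transpose_def)
  have "(norm (A ** B))\<^sup>2 = (\<Sum>i\<in>UNIV. \<Sum>j\<in>UNIV. (A $ i \<bullet> transpose B $ j)\<^sup>2)"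
    by (simp add: power2_norm_vec entry)
  also have "\<dots> \<le> (\<Sum>i\<in>UNIV. \<Sum>j\<in>UNIV. (norm (A $ i))\<^sup>2 * (norm (transpose B $ j))\<^sup>2)"
    by (intro sum_mono) (simp add: Cauchy_Schwarz_ineq power2_norm_eq_inner)
  also have "\<dots> = (norm A)\<^sup>2 * (norm (transpose B))\<^sup>2"
    unfolding power2_norm_vec[of A] power2_norm_vec[of "transpose B"] by (rule sum_product[symmetric])
  finally show "(norm (A ** B))\<^sup>2 \<le> (norm A * norm B)\<^sup>2"
    by (simp add: norm_transpose power_mult_distrib)
qed simp

text \<open>Carries quadratic bounds for single matrices over to tuples with the same constant: one
  factor is bounded by its tuple norm, the other is summed in squares.\<close>

lemma norm_vec_le_mult:
  fixes z :: "'a::real_normed_vector^'k" and x :: "'b::real_normed_vector^'k" and y :: "'c::real_normed_vector^'k"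
  assumes "\<And>i. norm (z $ i) \<le> c * (norm (x $ i) * norm (y $ i))" "0 \<le> c"
  shows "norm z \<le> c * (norm x * norm y)"
proof -
  have "norm (z $ i) \<le> (c * norm y) * norm (x $ i)" for i
  proof -
    have "c * (norm (x $ i) * norm (y $ i)) \<le> c * (norm (x $ i) * norm y)"
      by (intro mult_left_mono Finite_Cartesian_Product.norm_nth_le assms) auto
    then show ?thesis using assms(1)[of i] by (simp add: mult_ac)
  qed
  then have "norm z \<le> L2_set (\<lambda>i. (c * norm y) * norm (x $ i)) UNIV"
    unfolding norm_vec_def[of z] by (intro L2_set_mono) auto
  also have "\<dots> = (c * norm y) * norm x"
    unfolding norm_vec_def[of x] using assms(2) by (intro L2_set_right_distrib[symmetric]) simp
  finally show ?thesis by (simp add: mult_ac)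
qed

lemma SO_mult_transpose: "Q \<in> SO \<Longrightarrow> Q ** transpose Q = mat 1"
  and SO_transpose_mult: "Q \<in> SO \<Longrightarrow> transpose Q ** Q = mat 1"
  by (auto simp: SO_def rotation_matrix_def orthogonal_matrix_def)

lemma mat_1_in_SO: "mat 1 \<in> SO"
  by (simp add: SO_def rotation_matrix_def orthogonal_matrix_id)

lemma transpose_in_SO: "Q \<in> SO \<Longrightarrow> transpose Q \<in> SO"
  by (simp add: SO_def rotation_matrix_def)

lemma mult_in_SO: "P \<in> SO \<Longrightarrow> Q \<in> SO \<Longrightarrow> P ** Q \<in> SO"
  by (simp add: SO_def rotation_matrix_def orthogonal_matrix_mul det_mul)

lemma norm_SO_mult_left: "Q \<in> SO \<Longrightarrow> norm (Q ** X) = norm X"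
  by (simp add: norm_eq_sqrt_inner inner_matrix_mult_left matrix_mul_assoc SO_transpose_mult)

lemma norm_SO_mult_right: "Q \<in> SO \<Longrightarrow> norm (X ** Q) = norm X"
  by (simp add: norm_eq_sqrt_inner inner_matrix_mult_right SO_mult_transpose flip: matrix_mul_assoc)

lemma norm_SO: "Q \<in> SO \<Longrightarrow> norm Q = norm (mat 1 :: real^'n^'n)" for Q :: "real^'n^'n"
  using norm_SO_mult_left[of Q "mat 1"] by simp

lemma compact_SO: "compact (SO :: (real^'n^'n) set)"
proof -
  have "bounded (SO :: (real^'n^'n) set)"
    by (rule boundedI[of _ "norm (mat 1 :: real^'n^'n)"]) (simp add: norm_SO)
  moreover have "SO = {Q :: real^'n^'n. transpose Q ** Q = mat 1} \<inter> {Q. det Q = 1}"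
    by (auto simp: SO_def rotation_matrix_def orthogonal_matrix)
  moreover have "closed \<dots>"
    unfolding det_def
    by (intro closed_Int closed_Collect_eq continuous_intros bounded_bilinear.continuous_on[OF bounded_bilinear_matrix_mult]
        bounded_linear.continuous_on[OF bounded_linear_transpose])
  ultimately show ?thesis by (simp add: compact_eq_bounded_closed)
qed

lemma so_inner_mult_self:
  assumes "A \<in> so" shows "(x :: real^'n) \<bullet> (A *v x) = 0"
proof -
  have "x \<bullet> (A *v x) = (transpose A *v x) \<bullet> x"
    by (metis dot_lmul_matrix inner_commute vector_transpose_matrix transpose_transpose)
  also have "\<dots> = - (x \<bullet> (A *v x))"
    using assms matrix_vector_mult_diff_rdistrib[of 0 A x] by (simp add: so_def inner_commute)
  finally show ?thesis by simp
qed

lemma skew_in_so: "skew X \<in> so"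
  by (simp add: so_def skew_def transpose_linear algebra_simps flip: scaleR_minus_right)

lemma skew_symmetric: "transpose X = X \<Longrightarrow> skew X = 0"
  by (simp add: skew_def)

text \<open>\<open>skew\<close> is the orthogonal projection onto \<open>so\<close>, hence invisible
  when paired with an element of \<open>so\<close>.\<close>

lemma inner_skew:
  assumes "W \<in> so" shows "W \<bullet> skew X = W \<bullet> X"
proof -
  have "W \<bullet> transpose X = transpose W \<bullet> X"
    using inner_transpose[of W "transpose X"] by simp
  then show ?thesis using assms by (simp add: skew_def inner_diff_right so_def)
qed

lemma inner_skew_eq_norm: "X \<bullet> skew X = (norm (skew X))\<^sup>2"
  using inner_skew[OF skew_in_so, of X X] by (simp add: power2_norm_eq_inner inner_commute)

lemma norm_skew_le: "norm (skew X) \<le> norm X"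
proof -
  have "norm (skew X) * norm (skew X) \<le> norm X * norm (skew X)"
    using inner_skew_eq_norm[of X] norm_cauchy_schwarz[of X "skew X"] by (simp add: power2_eq_square)
  then show ?thesis by (cases "norm (skew X) = 0") auto
qed

lemma subspace_so: "subspace so"
  by (auto simp: so_def subspace_def transpose_linear)

lemma so_conj:
  assumes "W \<in> so" shows "transpose R ** W ** R \<in> so"
  using assms by (simp add: so_def matrix_transpose_mul matrix_mul_assoc matrix_mult_linear)

text \<open>The Cayley transform \<open>R = (I - A)\<^sup>-\<^sup>1 (I + A)\<close>, written as a fixed-point equation from which
  the expansion \<open>R = I + 2 A + O(|A|\<^sup>2)\<close> can be read off.\<close>

lemma cayley_transform:
  fixes A :: "real^'n^'n"
  assumes "A \<in> so"
  obtains R where "R \<in> SO" "R = mat 1 + A + A ** R"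
proof -
  define B where "B = mat 1 - A"
  have TB: "transpose B = mat 1 + A"
    using assms by (simp add: B_def transpose_linear so_def)
  have "x = 0" if "B *v x = 0" for x
  proof -
    have "x = A *v x" using that by (simp add: B_def matrix_vector_mult_diff_rdistrib)
    then have "x \<bullet> x = 0" using so_inner_mult_self[OF assms, of x] by simp
    then show ?thesis by simp
  qed
  then have "invertible B"
    using matrix_left_invertible_ker[of B] invertible_left_inverse by blast
  then obtain C where C: "B ** C = mat 1" "C ** B = mat 1"
    unfolding invertible_def by blast
  have comm: "transpose B ** B = B ** transpose B"
    unfolding TB unfolding B_def by (simp add: matrix_mult_linear)
  define R where "R = C ** transpose B"
  have BR: "B ** R = transpose B" by (simp add: R_def matrix_mul_assoc C)
  have "R ** transpose R = C ** (transpose B ** B) ** transpose C"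
    by (simp add: R_def matrix_transpose_mul matrix_mul_assoc)
  also have "\<dots> = (C ** B) ** (transpose B ** transpose C)"
    by (simp only: comm matrix_mul_assoc)
  also have "\<dots> = mat 1"
    by (metis C(1) C(2) matrix_mul_rid matrix_transpose_mul transpose_mat)
  finally have "orthogonal_matrix R"
    by (metis matrix_left_right_inverse orthogonal_matrix_def)
  \<comment> \<open>\<open>B ** R\<close> is the transpose of \<open>B\<close>, with the same
    nonzero determinant; this fixes the sign of \<open>det R\<close>.\<close>
  moreover have "det B * det R = det B * 1"
    by (metis BR det_mul det_transpose mult.right_neutral)
  then have "det R = 1"
    using \<open>invertible B\<close> by (simp add: invertible_det_nz)
  ultimately have "R \<in> SO" by (simp add: SO_def rotation_matrix_def)
  moreover have "R = mat 1 + A + A ** R"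
    using BR unfolding TB unfolding B_def by (simp add: matrix_mult_linear algebra_simps)
  ultimately show ?thesis using that by blast
qed

text \<open>\<open>R\<close> is an isometry, so \<open>A ** R\<close> is as long as
  \<open>A\<close>; feeding the equation into itself turns the remainder into
  \<open>A ** (R - mat 1)\<close>. Both bounds hold for \<open>A\<close> of any size.\<close>

lemma cayley_estimates:
  fixes A R :: "real^'n^'n"
  assumes "R \<in> SO" "R = mat 1 + A + A ** R"
  shows "norm (R - mat 1) \<le> 2 * norm A"
    and "norm (R - mat 1 - 2 *\<^sub>R A) \<le> 2 * (norm A)\<^sup>2"
proof -
  have "R - mat 1 = A + A ** R" using assms(2) by (simp add: algebra_simps)
  then have "norm (R - mat 1) \<le> norm A + norm (A ** R)" by (metis norm_triangle_ineq)
  then show 1: "norm (R - mat 1) \<le> 2 * norm A" by (simp add: norm_SO_mult_right[OF assms(1)])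
  have "R - mat 1 - 2 *\<^sub>R A = A ** (R - mat 1)"
    by (simp add: matrix_mult_linear scaleR_2) (subst assms(2), simp)
  then have "norm (R - mat 1 - 2 *\<^sub>R A) \<le> norm A * norm (R - mat 1)"
    by (simp add: norm_matrix_mult_le)
  also have "\<dots> \<le> norm A * (2 * norm A)" by (intro mult_left_mono 1) simp
  finally show "norm (R - mat 1 - 2 *\<^sub>R A) \<le> 2 * (norm A)\<^sup>2" by (simp add: power2_eq_square mult_ac)
qed

subsection \<open>Gradient flow of the edge Laplacian\<close>

lemma has_vector_derivative_imp_at:
  fixes g :: "real \<Rightarrow> 'a::real_normed_vector"
  assumes "(g has_vector_derivative g') (at t within {0..})" "0 < t"
  shows "(g has_vector_derivative g') (at t)"
  using assms at_within_interior[of t "{0..}"] by simp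

lemma nonincreasing_on_Ici:
  fixes g :: "real \<Rightarrow> real"
  assumes "\<And>t. 0 \<le> t \<Longrightarrow> (g has_vector_derivative g' t) (at t within {0..})"
    and "\<And>t. 0 \<le> t \<Longrightarrow> g' t \<le> 0" and "0 \<le> t"
  shows "g t \<le> g 0"
proof (rule DERIV_nonpos_imp_decreasing_open[OF \<open>0 \<le> t\<close>])
  fix x :: real assume "0 < x" "x < t"
  then have "(g has_real_derivative g' x) (at x)"
    unfolding has_real_derivative_iff_has_vector_derivative
    by (intro has_vector_derivative_imp_at assms(1)) auto
  moreover have "g' x \<le> 0" using \<open>0 < x\<close> by (intro assms(2)) simp
  ultimately show "\<exists>z. (g has_real_derivative z) (at x) \<and> z \<le> 0" by blast
next
  show "continuous_on {0..t} g"
  proof (rule continuous_on_subset)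
    show "continuous_on {0..} g"
      using assms(1) by (auto simp: continuous_on_eq_continuous_within intro: has_vector_derivative_continuous)
  qed simp
qed

text \<open>The last two bounds combine to a Polyak-Lojasiewicz inequality,
  \<open>(c / C) * e x \<le> (norm (f x))\<^sup>2\<close>, which makes \<open>e\<close> decay
  exponentially; \<open>lower\<close> translates this back into distance. All three hold only within
  distance \<open>r\<close>, so orbits must first be trapped there.\<close>

lemma exponential_stability_of_gradient_flow:
  fixes f :: "'a::real_normed_vector \<Rightarrow> 'a" and e :: "'a \<Rightarrow> real"
  assumes deriv: "\<And>Q t. is_solution f M Q \<Longrightarrow> 0 \<le> t \<Longrightarrow>
      ((\<lambda>t. e (Q t)) has_vector_derivative - 2 * (norm (f (Q t)))\<^sup>2) (at t within {0..})"
    and pos: "0 < r" "0 < c" "0 < C"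
    and lower: "\<And>x. x \<in> M \<Longrightarrow> infdist x S \<le> r \<Longrightarrow> c * (infdist x S)\<^sup>2 \<le> e x"
    and upper: "\<And>x. x \<in> M \<Longrightarrow> infdist x S \<le> r \<Longrightarrow> e x \<le> C * (infdist x S)\<^sup>2"
    and grad: "\<And>x. x \<in> M \<Longrightarrow> infdist x S \<le> r \<Longrightarrow> c * (infdist x S)\<^sup>2 \<le> (norm (f x))\<^sup>2"
  shows "locally_exponentially_stable f M S"
proof -
  let ?d = "\<lambda>x. infdist x S"
  define \<kappa> where "\<kappa> = 2 * c / C"
  \<comment> \<open>The second bound makes \<open>C * \<delta>\<^sup>2 \<le> c * r\<^sup>2\<close>:
    the initial energy stays below the least energy possible at distance \<open>r\<close>.\<close>
  define \<delta> where "\<delta> = min r (r * sqrt (c / C))"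
  have "\<delta> > 0" using pos by (simp add: \<delta>_def)
  have "?d (Q t) \<le> sqrt (C / c) * exp (- (\<kappa> / 2) * t) * ?d (Q 0)"
    if sol: "is_solution f M Q" and init: "?d (Q 0) < \<delta>" and t: "0 \<le> t" for Q t
  proof -
    have QM: "Q s \<in> M" and dQ: "(Q has_vector_derivative f (Q s)) (at s within {0..})" if "0 \<le> s" for s
      using sol that by (auto simp: is_solution_def)
    have contQ: "continuous_on {0..} Q"
      using dQ by (auto simp: continuous_on_eq_continuous_within intro: has_vector_derivative_continuous)
    have mono: "e (Q s) \<le> e (Q 0)" if "0 \<le> s" for s
      by (rule nonincreasing_on_Ici[OF deriv[OF sol]]) (use that in auto)
    have init_r: "?d (Q 0) \<le> r" using init by (simp add: \<delta>_def)
    have "e (Q 0) \<le> C * (?d (Q 0))\<^sup>2" by (intro upper QM init_r) simp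
    also have "\<dots> < C * (r * sqrt (c / C))\<^sup>2"
      using init pos by (intro mult_strict_left_mono power_strict_mono infdist_nonneg) (auto simp: \<delta>_def)
    also have "\<dots> = c * r\<^sup>2" using pos by (simp add: power_mult_distrib field_simps)
    finally have e0: "e (Q 0) < c * r\<^sup>2" .
    \<comment> \<open>An orbit leaving the tube would be at distance exactly \<open>r\<close> at
      some time, where the energy exceeds its initial value.\<close>
    have near: "?d (Q s) \<le> r" if s: "0 \<le> s" for s
    proof (rule ccontr)
      assume "\<not> ?d (Q s) \<le> r"
      moreover have "continuous_on {0..s} (\<lambda>s. ?d (Q s))"
        by (intro continuous_on_infdist continuous_on_subset[OF contQ]) auto
      ultimately obtain u where u: "0 \<le> u" "?d (Q u) = r"
        using IVT'[of "\<lambda>s. ?d (Q s)" 0 r s] init_r s by auto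
      then have "c * r\<^sup>2 \<le> e (Q u)" using lower[OF QM] by force
      then show False using mono[OF u(1)] e0 by simp
    qed
    have "e (Q t) * exp (\<kappa> * t) \<le> e (Q 0) * exp (\<kappa> * 0)"
    proof (rule nonincreasing_on_Ici[OF _ _ t])
      fix s :: real assume s: "0 \<le> s"
      show "((\<lambda>s. e (Q s) * exp (\<kappa> * s)) has_vector_derivative
          - 2 * (norm (f (Q s)))\<^sup>2 * exp (\<kappa> * s) + e (Q s) * (exp (\<kappa> * s) * \<kappa>)) (at s within {0..})"
        using deriv[OF sol s] unfolding has_real_derivative_iff_has_vector_derivative[symmetric]
        by (auto intro!: derivative_eq_intros)
      have "\<kappa> * e (Q s) \<le> \<kappa> * (C * (?d (Q s))\<^sup>2)"
        using pos by (intro mult_left_mono upper QM near s) (simp add: \<kappa>_def)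
      also have "\<dots> = 2 * (c * (?d (Q s))\<^sup>2)" using pos by (simp add: \<kappa>_def)
      also have "\<dots> \<le> 2 * (norm (f (Q s)))\<^sup>2" by (intro mult_left_mono grad QM near s) simp
      finally have "(\<kappa> * e (Q s) - 2 * (norm (f (Q s)))\<^sup>2) * exp (\<kappa> * s) \<le> 0"
        by (simp add: mult_le_0_iff)
      then show "- 2 * (norm (f (Q s)))\<^sup>2 * exp (\<kappa> * s) + e (Q s) * (exp (\<kappa> * s) * \<kappa>) \<le> 0"
        by (simp add: algebra_simps)
    qed
    then have "e (Q t) \<le> exp (- (\<kappa> * t)) * e (Q 0)" by (simp add: exp_minus field_simps)
    also have "\<dots> \<le> exp (- (\<kappa> * t)) * (C * (?d (Q 0))\<^sup>2)"
      by (intro mult_left_mono upper QM init_r) auto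
    finally have "c * (?d (Q t))\<^sup>2 \<le> exp (- (\<kappa> * t)) * (C * (?d (Q 0))\<^sup>2)"
      using lower[OF QM[OF t] near[OF t]] by simp
    then have "(?d (Q t))\<^sup>2 \<le> (C / c) * exp (- (\<kappa> * t)) * (?d (Q 0))\<^sup>2"
      using pos by (simp add: field_simps)
    also have "\<dots> = (sqrt (C / c) * exp (- (\<kappa> / 2) * t) * ?d (Q 0))\<^sup>2"
      using pos by (simp add: power_mult_distrib flip: exp_double)
    finally show ?thesis
      by (rule power2_le_imp_le) (use pos in \<open>auto intro!: mult_nonneg_nonneg infdist_nonneg\<close>)
  qed
  moreover have "sqrt (C / c) > 0" "\<kappa> / 2 > 0" using pos by (auto simp: \<kappa>_def)
  ultimately show ?thesis
    unfolding locally_exponentially_stable_def using \<open>\<delta> > 0\<close> by blast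
qed

section \<open>The edge Laplacian on tuples and its energy\<close>

lemma outer_mult_nth: "(outer v ** Z) $ r $ c = v $ r * (transpose Z *v v) $ c"
  by (simp add: outer_def matrix_matrix_mult_def matrix_vector_mult_def transpose_def sum_distrib_left mult_ac)

text \<open>\<open>outer v\<close> has rank one and sees \<open>Z\<close> only through
  \<open>transpose Z *v v\<close>; this makes edge energies squared lengths of vectors.\<close>

lemma inner_outer_mult: "Z \<bullet> (outer v ** Z') = (transpose Z *v v) \<bullet> (transpose Z' *v v)"
proof -
  have "Z \<bullet> (outer v ** Z') = (\<Sum>r\<in>UNIV. \<Sum>c\<in>UNIV. Z $ r $ c * (v $ r * (transpose Z' *v v) $ c))"
    by (simp add: inner_vec_def outer_mult_nth)
  also have "\<dots> = (\<Sum>c\<in>UNIV. \<Sum>r\<in>UNIV. Z $ r $ c * (v $ r * (transpose Z' *v v) $ c))"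
    by (rule sum.swap)
  also have "\<dots> = (transpose Z *v v) \<bullet> (transpose Z' *v v)"
  proof -
    have "(transpose Z *v v) $ c = (\<Sum>r\<in>UNIV. Z $ r $ c * v $ r)" for c
      by (simp add: matrix_vector_mult_def transpose_def)
    then show ?thesis unfolding inner_vec_def[of "transpose Z *v v"] by (simp only: sum_distrib_left sum_distrib_right inner_real_def mult_ac)
  qed
  finally show ?thesis .
qed

lemma transpose_outer: "transpose (outer v) = outer v"
  by (simp add: outer_def transpose_def vec_eq_iff mult.commute)

definition tuple_mult :: "real^'n^'n^'k \<Rightarrow> real^'n^'n^'k \<Rightarrow> real^'n^'n^'k" where
  "tuple_mult X Y = (\<chi> i. X $ i ** Y $ i)"

definition tuple_skew :: "real^'n^'n^'k \<Rightarrow> real^'n^'n^'k" where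
  "tuple_skew X = (\<chi> i. skew (X $ i))"

definition tuple_transpose :: "real^'n^'n^'k \<Rightarrow> real^'n^'n^'k" where
  "tuple_transpose X = (\<chi> i. transpose (X $ i))"

lemma bounded_bilinear_tuple_mult: "bounded_bilinear tuple_mult"
  by (auto simp: bilinear_conv_bounded_bilinear[symmetric] bilinear_def linear_iff tuple_mult_def
      vec_eq_iff matrix_mult_linear)

lemma bounded_linear_tuple_skew: "bounded_linear tuple_skew"
  by (auto simp: linear_conv_bounded_linear[symmetric] linear_iff tuple_skew_def vec_eq_iff skew_def
      transpose_linear algebra_simps)

lemma bounded_linear_tuple_transpose: "bounded_linear tuple_transpose"
  by (auto simp: linear_conv_bounded_linear[symmetric] linear_iff tuple_transpose_def vec_eq_iff transpose_linear)

lemma norm_tuple_mult_le: "norm (tuple_mult X Y) \<le> norm X * norm Y"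
  using norm_vec_le_mult[of "tuple_mult X Y" 1 X Y] by (simp add: tuple_mult_def norm_matrix_mult_le)

lemma norm_tuple_skew_le: "norm (tuple_skew X) \<le> norm X"
  by (rule norm_le_componentwise_cart) (simp add: tuple_skew_def norm_skew_le)

lemma norm_tuple_mult_SO: "Q \<in> SO_pow \<Longrightarrow> norm (tuple_mult Q X) = norm X"
  unfolding norm_vec_def[of X] norm_vec_def[of "tuple_mult Q X"]
  by (simp add: tuple_mult_def SO_pow_def norm_SO_mult_left)

lemma tuple_skew_in_so_pow: "tuple_skew X \<in> so_pow"
  by (simp add: tuple_skew_def so_pow_def skew_in_so)

lemma inner_tuple_skew: "W \<in> so_pow \<Longrightarrow> W \<bullet> tuple_skew X = W \<bullet> X"
  by (simp add: inner_vec_def[of W] tuple_skew_def so_pow_def inner_skew)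

lemma inner_tuple_mult_left: "tuple_mult X Y \<bullet> Z = Y \<bullet> tuple_mult (tuple_transpose X) Z"
  by (simp add: inner_vec_def[of Y] inner_vec_def[of _ Z] tuple_mult_def tuple_transpose_def inner_matrix_mult_left)

locale reference_graph =
  fixes E :: "('k::finite \<times> 'k) set" and y :: "'k \<Rightarrow> 'k \<Rightarrow> real^'n::finite"
  assumes edge_sym: "(i, j) \<in> E \<Longrightarrow> (j, i) \<in> E"
    and reference_sym: "(i, j) \<in> E \<Longrightarrow> y i j = y j i"
begin

definition lap :: "real^'n^'n^'k \<Rightarrow> real^'n^'n^'k" where
  "lap X = (\<chi> i. \<Sum>j | (i, j) \<in> E. outer (y i j) ** (X $ i - X $ j))"

text \<open>The residual, on one edge, of the equation defining \<open>C_o\<close>.\<close>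

definition defect :: "real^'n^'n^'k \<Rightarrow> 'k \<Rightarrow> 'k \<Rightarrow> real^'n" where
  "defect X i j = transpose (X $ i - X $ j) *v y i j"

text \<open>The kernel of \<open>lap\<close> always contains the consensus tuples; on skew tuples
  there shall be nothing else. Stability of \<open>C_s\<close> and the rank condition on
  \<open>V\<close> are both proved equivalent to this.\<close>

definition consensus_kernel :: bool where
  "consensus_kernel \<longleftrightarrow> (\<forall>W\<in>so_pow. lap W = 0 \<longrightarrow> (\<forall>i j. W $ i = W $ j))"

lemma bounded_linear_lap: "bounded_linear lap"
  proof -
  have "lap (X + Y) $ i = (lap X + lap Y) $ i" for X Y i
    unfolding lap_def by (simp add: matrix_mult_linear add_diff_add sum.distrib)
  moreover have "lap (c *\<^sub>R X) $ i = (c *\<^sub>R lap X) $ i" for c X i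
    unfolding lap_def by (simp add: matrix_mult_linear scaleR_sum_right flip: scaleR_diff_right)
  ultimately have "linear lap"
    by (intro linearI) (simp_all add: vec_eq_iff)
  then show ?thesis by (simp add: linear_conv_bounded_linear)
qed

lemmas lap_linear =
  linear_add[OF bounded_linear.linear[OF bounded_linear_lap]]
  linear_diff[OF bounded_linear.linear[OF bounded_linear_lap]]
  linear_cmul[OF bounded_linear.linear[OF bounded_linear_lap]]
  linear_0[OF bounded_linear.linear[OF bounded_linear_lap]]

lemma sum_edges_swap:
  fixes g :: "'k \<Rightarrow> 'k \<Rightarrow> real"
  shows "(\<Sum>i\<in>UNIV. \<Sum>j | (i, j) \<in> E. g i j) = (\<Sum>i\<in>UNIV. \<Sum>j | (i, j) \<in> E. g j i)"
proof -
  have eq: "(\<Sum>j | (i, j) \<in> E. h j) = (\<Sum>j\<in>UNIV. if (i, j) \<in> E then h j else 0)"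
    for h :: "'k \<Rightarrow> real" and i
    by (simp add: sum.If_cases)
  have "(\<Sum>i\<in>UNIV. \<Sum>j\<in>UNIV. if (i, j) \<in> E then g i j else 0) =
      (\<Sum>j\<in>UNIV. \<Sum>i\<in>UNIV. if (i, j) \<in> E then g i j else 0)"
    by (rule sum.swap)
  also have "\<dots> = (\<Sum>j\<in>UNIV. \<Sum>i\<in>UNIV. if (j, i) \<in> E then g i j else 0)"
    by (intro sum.cong refl if_cong) (blast intro: edge_sym)
  finally show ?thesis unfolding eq .
qed

text \<open>Adding the terms of an edge and its reverse replaces \<open>X $ i\<close> by
  \<open>X $ i - X $ j\<close>, as both carry the same outer product; the 1/2 corrects for counting
  edges in both directions. Self-adjointness and semidefiniteness are read off from this.\<close>

lemma inner_lap: "X \<bullet> lap Y = (\<Sum>i\<in>UNIV. \<Sum>j | (i, j) \<in> E. defect X i j \<bullet> defect Y i j) / 2"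
proof -
  let ?g = "\<lambda>i j. X $ i \<bullet> (outer (y i j) ** (Y $ i - Y $ j))"
  have 1: "X \<bullet> lap Y = (\<Sum>i\<in>UNIV. \<Sum>j | (i, j) \<in> E. ?g i j)"
    by (simp add: inner_vec_def[of X] lap_def inner_sum_right)
  have "2 * (X \<bullet> lap Y) = (\<Sum>i\<in>UNIV. \<Sum>j | (i, j) \<in> E. ?g i j + ?g j i)"
    using 1 sum_edges_swap[of ?g] by (simp add: sum.distrib)
  also have "\<dots> = (\<Sum>i\<in>UNIV. \<Sum>j | (i, j) \<in> E. defect X i j \<bullet> defect Y i j)"
  proof (intro sum.cong refl)
    fix i j assume "j \<in> {j. (i, j) \<in> E}"
    then have "y i j = y j i" by (intro reference_sym) simp
    then have "?g i j + ?g j i = (X $ i - X $ j) \<bullet> (outer (y i j) ** (Y $ i - Y $ j))"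
      by (simp add: matrix_mult_linear inner_diff_left inner_diff_right)
    then show "?g i j + ?g j i = defect X i j \<bullet> defect Y i j"
      by (simp add: inner_outer_mult defect_def)
  qed
  finally show ?thesis by simp
qed

lemma lap_selfadjoint: "X \<bullet> lap Y = lap X \<bullet> Y"
  by (simp add: inner_lap inner_commute[of "lap X"] inner_commute[of "defect X _ _"])

lemma lap_nonneg: "0 \<le> X \<bullet> lap X"
  by (simp add: inner_lap sum_nonneg)

lemma lap_eq_0_iff_defect: "lap X = 0 \<longleftrightarrow> (\<forall>(i, j)\<in>E. defect X i j = 0)"
proof
  assume "lap X = 0"
  then have "(\<Sum>i\<in>UNIV. \<Sum>j | (i, j) \<in> E. defect X i j \<bullet> defect X i j) = 0"
    using inner_lap[of X X] by simp
  then show "\<forall>(i, j)\<in>E. defect X i j = 0"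
    by (auto simp: sum_nonneg_eq_0_iff sum_nonneg)
next
  assume "\<forall>(i, j)\<in>E. defect X i j = 0"
  then show "lap X = 0"
    by (auto simp: lap_def vec_eq_iff outer_mult_nth defect_def intro!: sum.neutral)
qed

lemma lap_eq_0_iff_inner: "lap X = 0 \<longleftrightarrow> X \<bullet> lap X = 0"
proof
  assume "X \<bullet> lap X = 0"
  then have "(\<Sum>i\<in>UNIV. \<Sum>j | (i, j) \<in> E. defect X i j \<bullet> defect X i j) = 0"
    using inner_lap[of X X] by simp
  then show "lap X = 0"
    unfolding lap_eq_0_iff_defect by (auto simp: sum_nonneg_eq_0_iff sum_nonneg)
qed simp

lemma lap_consensus:
  assumes "\<And>i j. X $ i = X $ j" shows "lap X = 0"
proof -
  have "defect X i j = 0" for i j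
    unfolding defect_def assms[of i j] by (simp add: transpose_linear)
  then show ?thesis by (simp add: lap_eq_0_iff_defect)
qed

text \<open>The Laplacian multiplies from the left only, so it commutes with a common right
  rotation. This symmetry moves the nearest consensus state to the identity.\<close>

lemma lap_mult_right: "lap (\<chi> i. X $ i ** R) $ i = lap X $ i ** R"
  by (simp add: lap_def matrix_mult_linear matrix_mul_assoc)

text \<open>The product of the transpose of \<open>Q $ i\<close>, the outer product and
  \<open>Q $ i\<close> is symmetric, so it may be subtracted inside \<open>skew\<close>; this turns
  \<open>Q $ j\<close> into a difference and reveals the Laplacian.\<close>

lemma dynamics_eq: "dynamics E y Q = - tuple_mult Q (tuple_skew (tuple_mult (tuple_transpose Q) (lap Q)))"
proof -
  have "skew (transpose (Q $ i) ** outer (y i j) ** Q $ j) =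
      - skew (transpose (Q $ i) ** (outer (y i j) ** (Q $ i - Q $ j)))" for i j
  proof -
    have "transpose (transpose (Q $ i) ** outer (y i j) ** Q $ i) = transpose (Q $ i) ** outer (y i j) ** Q $ i"
      by (simp add: matrix_transpose_mul transpose_outer matrix_mul_assoc)
    then have "skew (transpose (Q $ i) ** outer (y i j) ** Q $ i) = 0" by (rule skew_symmetric)
    then show ?thesis
      by (simp add: matrix_mult_linear matrix_mul_assoc linear_diff[OF bounded_linear.linear[OF bounded_linear_skew]])
  qed
  then have "dynamics E y Q $ i = - tuple_mult Q (tuple_skew (tuple_mult (tuple_transpose Q) (lap Q))) $ i" for i
    by (simp add: dynamics_def tuple_mult_def tuple_skew_def tuple_transpose_def lap_def matrix_mult_linear sum_negf
        linear_sum[OF bounded_linear.linear[OF bounded_linear_skew]])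
  then show ?thesis by (simp add: vec_eq_iff)
qed

lemma norm_dynamics:
  "Q \<in> SO_pow \<Longrightarrow> norm (dynamics E y Q) = norm (tuple_skew (tuple_mult (tuple_transpose Q) (lap Q)))"
  by (simp add: dynamics_eq norm_tuple_mult_SO)

text \<open>The field is minus the orthogonal projection of \<open>lap Q\<close> onto the tangent
  space of \<open>SO_pow\<close> at \<open>Q\<close>.\<close>

lemma inner_lap_dynamics:
  assumes "Q \<in> SO_pow" shows "lap Q \<bullet> dynamics E y Q = - (norm (dynamics E y Q))\<^sup>2"
proof -
  let ?X = "tuple_mult (tuple_transpose Q) (lap Q)"
  have "lap Q \<bullet> dynamics E y Q = - (tuple_mult Q (tuple_skew ?X) \<bullet> lap Q)"
    by (simp add: dynamics_eq inner_commute)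
  also have "\<dots> = - (tuple_skew ?X \<bullet> ?X)" by (simp add: inner_tuple_mult_left)
  also have "\<dots> = - (norm (tuple_skew ?X))\<^sup>2"
    using inner_tuple_skew[OF tuple_skew_in_so_pow, of ?X ?X] by (simp add: power2_norm_eq_inner)
  finally show ?thesis by (simp add: norm_dynamics[OF assms])
qed

lemma energy_deriv:
  assumes "is_solution (dynamics E y) SO_pow Q" "0 \<le> t"
  shows "((\<lambda>t. Q t \<bullet> lap (Q t)) has_vector_derivative - 2 * (norm (dynamics E y (Q t)))\<^sup>2) (at t within {0..})"
proof -
  have Q: "(Q has_vector_derivative dynamics E y (Q t)) (at t within {0..})" and SO: "Q t \<in> SO_pow"
    using assms by (auto simp: is_solution_def)
  have "((\<lambda>t. Q t \<bullet> lap (Q t)) has_vector_derivative Q t \<bullet> lap (dynamics E y (Q t)) + dynamics E y (Q t) \<bullet> lap (Q t))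
      (at t within {0..})"
    by (intro bounded_bilinear.has_vector_derivative[OF bounded_bilinear_inner] Q
        bounded_linear.has_vector_derivative[OF bounded_linear_lap])
  then show ?thesis
    using inner_lap_dynamics[OF SO]
    unfolding lap_selfadjoint[of "Q t"] inner_commute[of "dynamics E y (Q t)"] by simp
qed

end

subsection \<open>Solutions on the rotation group\<close>

lemma lipschitz_on_bounded_bilinear:
  assumes "bounded_bilinear h" "\<exists>L. L-lipschitz_on X f" "\<exists>L. L-lipschitz_on X g"
    and "bounded (f ` X)" "bounded (g ` X)"
  shows "\<exists>L. L-lipschitz_on X (\<lambda>x. h (f x) (g x))"
proof -
  interpret bounded_bilinear h by fact
  obtain K where K: "0 \<le> K" "\<And>a b. norm (h a b) \<le> norm a * norm b * K"
    using nonneg_bounded by blast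
  obtain Lf Lg where L: "Lf-lipschitz_on X f" "Lg-lipschitz_on X g" using assms(2,3) by blast
  obtain Bf Bg where B: "0 < Bf" "0 < Bg" "\<And>x. x \<in> X \<Longrightarrow> norm (f x) \<le> Bf" "\<And>x. x \<in> X \<Longrightarrow> norm (g x) \<le> Bg"
    using assms(4,5) unfolding bounded_pos by auto
  have nonneg: "0 \<le> Lf" "0 \<le> Lg" using L lipschitz_on_nonneg by auto
  have "(K * (Bf * Lg + Lf * Bg))-lipschitz_on X (\<lambda>x. h (f x) (g x))"
  proof (rule lipschitz_onI)
    fix a b assume ab: "a \<in> X" "b \<in> X"
    have "h (f a) (g a) - h (f b) (g b) = h (f a) (g a - g b) + h (f a - f b) (g b)"
      by (simp add: diff_left diff_right)
    then have "dist (h (f a) (g a)) (h (f b) (g b))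
        \<le> norm (h (f a) (g a - g b)) + norm (h (f a - f b) (g b))"
      unfolding dist_norm by (metis norm_triangle_ineq)
    also have "\<dots> \<le> norm (f a) * norm (g a - g b) * K + norm (f a - f b) * norm (g b) * K"
      by (intro add_mono K)
    also have "\<dots> \<le> Bf * (Lg * dist a b) * K + (Lf * dist a b) * Bg * K"
      using lipschitz_onD[OF L(1) ab] lipschitz_onD[OF L(2) ab] B(3)[OF ab(1)] B(4)[OF ab(2)] B(1,2) nonneg K(1)
      unfolding dist_norm[of "f a"] dist_norm[of "g a"]
      by (intro add_mono mult_mono mult_nonneg_nonneg) (assumption | simp)+
    finally show "dist (h (f a) (g a)) (h (f b) (g b)) \<le> K * (Bf * Lg + Lf * Bg) * dist a b"
      by (simp add: algebra_simps)
  qed (use nonneg B K in auto)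
  then show ?thesis by blast
qed

lemma lipschitz_on_bounded_linear:
  assumes "bounded_linear T" "\<exists>L. L-lipschitz_on X f"
  shows "\<exists>L. L-lipschitz_on X (\<lambda>x. T (f x))"
proof -
  obtain L where "L-lipschitz_on X f" using assms(2) by blast
  moreover obtain B where "B-lipschitz_on (f ` X) T" using bounded_linear.lipschitz_boundE[OF assms(1)] .
  ultimately show ?thesis using lipschitz_on_compose2 by blast
qed

lemma closest_point_cball_0:
  fixes x :: "'a::euclidean_space"
  assumes "0 \<le> \<rho>"
  obtains c where "closest_point (cball 0 \<rho>) x = c *\<^sub>R x"
proof (cases "norm x \<le> \<rho>")
  case True
  then show ?thesis using that[of 1] by (simp add: closest_point_self)
next
  case False
  then have x: "norm x > \<rho>" "norm x > 0" using assms by auto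
  have "(\<rho> / norm x) *\<^sub>R x = closest_point (cball 0 \<rho>) x"
  proof (rule closest_point_unique)
    show "\<forall>z\<in>cball 0 \<rho>. dist x ((\<rho> / norm x) *\<^sub>R x) \<le> dist x z"
    proof
      fix z :: 'a assume "z \<in> cball 0 \<rho>"
      have "x - (\<rho> / norm x) *\<^sub>R x = (1 - \<rho> / norm x) *\<^sub>R x" by (simp add: scaleR_left_diff_distrib)
      then have "dist x ((\<rho> / norm x) *\<^sub>R x) = (1 - \<rho> / norm x) * norm x"
        using x by (simp add: dist_norm)
      also have "\<dots> = norm x - \<rho>" using x by (simp add: field_simps)
      also have "\<dots> \<le> dist x z"
        using \<open>z \<in> cball 0 \<rho>\<close> norm_triangle_sub[of x z] by (simp add: dist_norm)
      finally show "dist x ((\<rho> / norm x) *\<^sub>R x) \<le> dist x z" .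
    qed
  qed (use x assms in auto)
  then show ?thesis using that by metis
qed

text \<open>Source of both conservation laws below: for the norm of \<open>Q\<close> and for the
  deviation from orthogonality.\<close>

lemma inner_symmetric_so:
  assumes "transpose S = S" "A \<in> so" shows "S \<bullet> A = 0"
  using inner_skew[OF assms(2), of S] skew_symmetric[OF assms(1)] by (simp add: inner_commute)

lemma constant_on_Ici:
  fixes g :: "real \<Rightarrow> 'a::real_normed_vector"
  assumes "\<And>t. 0 \<le> t \<Longrightarrow> (g has_vector_derivative 0) (at t within {0..})" "0 \<le> t"
  shows "g t = g 0"
proof -
  obtain c where "\<And>s. s \<in> {0..} \<Longrightarrow> g s = c"
    using has_vector_derivative_zero_constant[of "{0..}" g] assms(1) by auto
  then show ?thesis using assms(2) by simp
qed

context reference_graph begin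

text \<open>The field is a cubic polynomial, assembled from bounded linear maps and two products,
  each Lipschitz on bounded sets.\<close>

lemma lipschitz_on_dynamics:
  assumes "bounded X" shows "\<exists>L. L-lipschitz_on X (dynamics E y)"
proof -
  have id: "\<exists>L. L-lipschitz_on X (\<lambda>Q. Q)" using lipschitz_on_id by blast
  have img: "bounded (T ` X)" if "bounded_linear T" for T :: "real^'n^'n^'k \<Rightarrow> real^'n^'n^'k"
    using bounded_linear_image[OF assms that] .
  have inner: "\<exists>L. L-lipschitz_on X (\<lambda>Q. tuple_skew (tuple_mult (tuple_transpose Q) (lap Q)))"
    by (intro lipschitz_on_bounded_linear[OF bounded_linear_tuple_skew]
        lipschitz_on_bounded_bilinear[OF bounded_bilinear_tuple_mult]
        lipschitz_on_bounded_linear[OF bounded_linear_tuple_transpose]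
        lipschitz_on_bounded_linear[OF bounded_linear_lap] id img
        bounded_linear_tuple_transpose bounded_linear_lap)
  obtain B where B: "\<And>Q. Q \<in> X \<Longrightarrow> norm Q \<le> B" using assms unfolding bounded_iff by blast
  obtain K where K: "\<And>Q. norm (lap Q) \<le> norm Q * K" using bounded_linear.nonneg_bounded[OF bounded_linear_lap] by blast
  obtain T where T: "\<And>Q :: real^'n^'n^'k. norm (tuple_transpose Q) \<le> norm Q * T" "0 \<le> T"
    using bounded_linear.nonneg_bounded[OF bounded_linear_tuple_transpose] by blast
  have "bounded ((\<lambda>Q. tuple_skew (tuple_mult (tuple_transpose Q) (lap Q))) ` X)"
  proof (rule boundedI)
    fix Z assume "Z \<in> (\<lambda>Q. tuple_skew (tuple_mult (tuple_transpose Q) (lap Q))) ` X"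
    then obtain Q where Q: "Q \<in> X" and Z: "Z = tuple_skew (tuple_mult (tuple_transpose Q) (lap Q))" by blast
    have "norm Z \<le> norm (tuple_transpose Q) * norm (lap Q)"
      unfolding Z using norm_tuple_skew_le norm_tuple_mult_le order_trans by blast
    also have "\<dots> \<le> (norm Q * T) * (norm Q * K)"
      by (intro mult_mono T K) (use order_trans[OF norm_ge_zero T(1)] in auto)
    also have "\<dots> = (norm Q)\<^sup>2 * T * K" by (simp add: power2_eq_square)
    also have "\<dots> \<le> \<bar>(norm Q)\<^sup>2 * T * K\<bar>" by simp
    also have "\<dots> = (norm Q)\<^sup>2 * \<bar>T * K\<bar>" by (simp add: abs_mult)
    also have "\<dots> \<le> B\<^sup>2 * \<bar>T * K\<bar>" by (intro mult_right_mono power_mono B Q) auto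
    finally show "norm Z \<le> B\<^sup>2 * \<bar>T * K\<bar>" .
  qed
  then have "\<exists>L. L-lipschitz_on X (\<lambda>Q. tuple_mult Q (tuple_skew (tuple_mult (tuple_transpose Q) (lap Q))))"
    using assms by (intro lipschitz_on_bounded_bilinear[OF bounded_bilinear_tuple_mult id inner]) simp_all
  then show ?thesis unfolding dynamics_eq by simp
qed

text \<open>The field is Lipschitz only on bounded sets, so it is precomposed with the radial retraction onto
  the ball through the initial point.  The retraction only rescales the argument, hence \<open>norm Q\<close> is
  conserved and the solution never leaves the ball.\<close>

lemma dynamics_solution_exists:
  assumes Q0: "Q0 \<in> SO_pow"
  obtains Q where "is_solution (dynamics E y) SO_pow Q" "Q 0 = Q0"
proof -
  define \<rho> where "\<rho> = norm Q0"
  define \<pi> where "\<pi> = closest_point (cball (0 :: real^'n^'n^'k) \<rho>)"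
  have \<rho>: "0 \<le> \<rho>" by (simp add: \<rho>_def)
  obtain L where L: "L-lipschitz_on (cball 0 \<rho>) (dynamics E y)"
    using lipschitz_on_dynamics[of "cball 0 \<rho>"] by auto
  have "(L * 1)-lipschitz_on UNIV (\<lambda>Q. dynamics E y (\<pi> Q))"
  proof (rule lipschitz_on_compose2[where g = "dynamics E y" and f = \<pi>])
    show "1-lipschitz_on UNIV \<pi>"
      using \<rho> by (intro lipschitz_onI) (auto simp: \<pi>_def intro!: closest_point_lipschitz)
    have "\<pi> ` UNIV \<subseteq> cball 0 \<rho>" using \<rho> by (auto simp: \<pi>_def simp del: mem_cball intro!: closest_point_in_set)
    then show "L-lipschitz_on (range \<pi>) (dynamics E y)" using L lipschitz_on_subset by blast
  qed
  then obtain Q where Q_0: "Q 0 = Q0"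
    and dQ\<pi>: "\<And>t. 0 \<le> t \<Longrightarrow> (Q has_vector_derivative dynamics E y (\<pi> (Q t))) (at t within {0..})"
    using lipschitz_ode_solution by blast
  have normQ: "norm (Q t) = \<rho>" if "0 \<le> t" for t
  proof -
    have "Q t \<bullet> Q t = Q 0 \<bullet> Q 0"
    proof (rule constant_on_Ici[OF _ that])
      fix s :: real assume s: "0 \<le> s"
      obtain c where c: "\<pi> (Q s) = c *\<^sub>R Q s" unfolding \<pi>_def using closest_point_cball_0[OF \<rho>] by metis
      define W where "W = tuple_skew (tuple_mult (tuple_transpose (\<pi> (Q s))) (lap (\<pi> (Q s))))"
      \<comment> \<open>The outer factor of the field is \<open>c\<close> times \<open>Q s\<close>,
        which leaves the skew \<open>W\<close> paired with the symmetric product of the transpose of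
        \<open>Q s\<close> and \<open>Q s\<close>, whatever \<open>c\<close> is.\<close>
      have "dynamics E y (\<pi> (Q s)) \<bullet> Q s = - (c * (tuple_mult (Q s) W \<bullet> Q s))"
        by (subst dynamics_eq, fold W_def) (simp add: c bounded_bilinear.scaleR_left[OF bounded_bilinear_tuple_mult])
      also have "tuple_mult (Q s) W \<bullet> Q s = (\<Sum>i\<in>UNIV. W $ i \<bullet> (transpose (Q s $ i) ** Q s $ i))"
        unfolding inner_tuple_mult_left inner_vec_def[of W] by (simp add: tuple_mult_def tuple_transpose_def)
      also have "\<dots> = 0"
      proof (intro sum.neutral ballI)
        fix i
        have "W $ i \<in> so" using tuple_skew_in_so_pow unfolding W_def so_pow_def by blast
        then show "W $ i \<bullet> (transpose (Q s $ i) ** Q s $ i) = 0"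
          by (subst inner_commute) (simp add: inner_symmetric_so matrix_transpose_mul)
      qed
      finally have "dynamics E y (\<pi> (Q s)) \<bullet> Q s = 0" by simp
      then show "((\<lambda>t. Q t \<bullet> Q t) has_vector_derivative 0) (at s within {0..})"
        using bounded_bilinear.has_vector_derivative[OF bounded_bilinear_inner dQ\<pi>[OF s] dQ\<pi>[OF s]]
        by (simp add: inner_commute)
    qed
    then show ?thesis by (simp add: norm_eq_sqrt_inner \<rho>_def Q_0)
  qed
  have dQ: "(Q has_vector_derivative dynamics E y (Q t)) (at t within {0..})" if "0 \<le> t" for t
    using dQ\<pi>[OF that] normQ[OF that] by (simp add: \<pi>_def closest_point_self)
  have "Q t \<in> SO_pow" if t: "0 \<le> t" for t
    unfolding SO_pow_def
  proof (intro CollectI allI)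
    fix i
    define P where "P s = Q s $ i" for s
    define A where "A s = - skew (transpose (P s) ** lap (Q s) $ i)" for s
    have A: "A s \<in> so" for s
      unfolding A_def using subspace_so skew_in_so subspace_neg by blast
    have P0: "P 0 \<in> SO" using Q0 by (simp add: P_def Q_0 SO_pow_def)
    have dP: "(P has_vector_derivative P s ** A s) (at s within {0..})" if "0 \<le> s" for s
      unfolding P_def using bounded_linear.has_vector_derivative[OF bounded_linear_vec_nth dQ[OF that]]
      by (simp add: dynamics_eq tuple_mult_def tuple_skew_def tuple_transpose_def A_def P_def matrix_mult_linear)
    \<comment> \<open>As \<open>A\<close> is skew, \<open>S\<close> evolves by its commutator with
      \<open>A\<close>. The identity commutes with \<open>A\<close>, so \<open>Z\<close> obeys the
      same linear equation; its norm is conserved and starts at 0.\<close>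
    define S where "S s = transpose (P s) ** P s" for s
    define Z where "Z s = S s - mat 1" for s
    have symZ: "transpose (Z s) = Z s" for s
      by (simp add: Z_def S_def transpose_linear matrix_transpose_mul transpose_mat)
    have dZ: "(Z has_vector_derivative Z s ** A s - A s ** Z s) (at s within {0..})" if "0 \<le> s" for s
    proof -
      have "(S has_vector_derivative transpose (P s) ** (P s ** A s) + transpose (P s ** A s) ** P s) (at s within {0..})"
        unfolding S_def
        by (intro bounded_bilinear.has_vector_derivative[OF bounded_bilinear_matrix_mult]
            bounded_linear.has_vector_derivative[OF bounded_linear_transpose] dP that)
      moreover have "transpose (P s) ** (P s ** A s) + transpose (P s ** A s) ** P s = Z s ** A s - A s ** Z s"
        using A[of s] by (simp add: Z_def S_def so_def matrix_transpose_mul matrix_mul_assoc matrix_mult_linear)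
      ultimately show ?thesis
        unfolding Z_def by (auto intro!: derivative_eq_intros)
    qed
    have const: "Z u \<bullet> Z u = Z 0 \<bullet> Z 0" if "0 \<le> u" for u
    proof (rule constant_on_Ici[OF _ that])
      fix s :: real assume s: "0 \<le> s"
      have ZZ: "transpose (Z s ** Z s) = Z s ** Z s" by (simp add: matrix_transpose_mul symZ)
      have "(Z s ** A s) \<bullet> Z s = 0" "(A s ** Z s) \<bullet> Z s = 0"
        unfolding inner_matrix_mult_left[of "Z s" "A s"] inner_matrix_mult_right[of "A s" "Z s"] symZ
        using inner_symmetric_so[OF ZZ A, of s] by (simp_all add: inner_commute)
      then show "((\<lambda>t. Z t \<bullet> Z t) has_vector_derivative 0) (at s within {0..})"
        using bounded_bilinear.has_vector_derivative[OF bounded_bilinear_inner dZ[OF s] dZ[OF s]]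
        by (simp add: inner_commute inner_diff_right)
    qed
    have Z_iff: "Z s = 0 \<longleftrightarrow> orthogonal_matrix (P s)" for s
      by (simp add: Z_def S_def orthogonal_matrix)
    have "Z 0 = 0" using P0 unfolding Z_iff by (simp add: SO_def rotation_matrix_def)
    then have orth: "orthogonal_matrix (P s)" if "0 \<le> s" for s
      using const[OF that] by (simp flip: Z_iff)
    have "continuous_on {0..} P"
      using dP by (auto simp: continuous_on_eq_continuous_within intro: has_vector_derivative_continuous)
    then have "continuous_on {0..t} P" by (rule continuous_on_subset) simp
    then have cont: "continuous_on {0..t} (\<lambda>s. det (P s))"
      unfolding det_def by (intro continuous_intros)
    \<comment> \<open>Orthogonality leaves only the values 1 and -1, and a continuous passage
      between them would cross 0.\<close>
    have "det (P t) = 1"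
    proof (rule ccontr)
      assume "det (P t) \<noteq> 1"
      then have "det (P t) = - 1" using det_orthogonal_matrix[OF orth[OF t]] by blast
      moreover have "det (P 0) = 1" using P0 by (simp add: SO_def rotation_matrix_def)
      ultimately obtain s where "0 \<le> s" "det (P s) = 0"
        using IVT2'[of "\<lambda>s. det (P s)" t 0 0] t cont by auto
      then show False using det_orthogonal_matrix[OF orth, of s] by simp
    qed
    then show "Q t $ i \<in> SO"
      using orth[OF t] by (simp add: P_def SO_def rotation_matrix_def)
  qed
  then show ?thesis using that Q_0 dQ by (auto simp: is_solution_def)
qed

end

subsection \<open>Stability when the kernel is consensus\<close>

lemma C_s_eq: "C_s = (\<lambda>R. \<chi> i. R) ` SO"
  by (auto simp: C_s_def SO_pow_def vec_eq_iff image_iff) metis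

lemma const_bounded_linear: "bounded_linear (\<lambda>R :: 'a::euclidean_space. \<chi> i. R)"
  by (auto simp: linear_conv_bounded_linear[symmetric] linear_iff vec_eq_iff)

lemma compact_C_s: "compact (C_s :: (real^'n^'n^'k) set)"
  unfolding C_s_eq
  by (intro compact_continuous_image compact_SO bounded_linear.continuous_on[OF const_bounded_linear] continuous_intros)

lemma C_s_nonempty: "C_s \<noteq> {}"
  unfolding C_s_eq using mat_1_in_SO by blast

text \<open>Divide by \<open>t\<close> and let it tend to 0. First-order information is extracted
  this way twice: from optimality of the nearest state, and from the slow motion along a kernel
  direction.\<close>

lemma linear_le_quadratic_imp_nonpos:
  fixes a K t0 :: real
  assumes "0 < t0" "\<And>t. 0 < t \<Longrightarrow> t < t0 \<Longrightarrow> a * t \<le> K * t\<^sup>2"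
  shows "a \<le> 0"
proof (rule ccontr)
  assume "\<not> a \<le> 0"
  then have a: "0 < a" by simp
  \<comment> \<open>Small enough that \<open>K * t\<close> is at most \<open>a / 2\<close>; the
    absolute value and the 1 cover nonpositive \<open>K\<close>.\<close>
  define t where "t = min (t0 / 2) (a / (2 * (\<bar>K\<bar> + 1)))"
  have t: "0 < t" "t < t0" "t \<le> a / (2 * (\<bar>K\<bar> + 1))"
    using a assms(1) by (auto simp: t_def min_less_iff_disj)
  have "a \<le> K * t" using assms(2)[OF t(1,2)] t(1) by (simp add: power2_eq_square)
  also have "\<dots> \<le> (\<bar>K\<bar> + 1) * t" using t(1) by (intro mult_right_mono) auto
  also have "\<dots> \<le> (\<bar>K\<bar> + 1) * (a / (2 * (\<bar>K\<bar> + 1)))" by (intro mult_left_mono t) auto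
  also have "\<dots> = a / 2" by (simp add: field_simps)
  finally show False using a by simp
qed

text \<open>The minimum over the compact unit sphere of \<open>S\<close> is positive, and both sides
  are homogeneous of degree two.\<close>

lemma coercive_on_subspace:
  fixes T :: "'a::euclidean_space \<Rightarrow> 'a"
  assumes T: "bounded_linear T" and S: "subspace S"
    and pos: "\<And>x. x \<in> S \<Longrightarrow> x \<noteq> 0 \<Longrightarrow> 0 < x \<bullet> T x"
  obtains l where "0 < l" "\<And>x. x \<in> S \<Longrightarrow> l * (norm x)\<^sup>2 \<le> x \<bullet> T x"
proof -
  interpret bounded_linear T by fact
  define K where "K = S \<inter> sphere 0 1"
  have unit: "(1 / norm x) *\<^sub>R x \<in> K" if "x \<in> S" "x \<noteq> 0" for x
    using that S by (auto simp: K_def subspace_scale)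
  show ?thesis
  proof (cases "K = {}")
    \<comment> \<open>Here \<open>S\<close> is the zero space and any constant works.\<close>
    case True
    show ?thesis
    proof (rule that[of 1])
      fix x assume "x \<in> S"
      then have "x = 0" using unit True by blast
      then show "1 * (norm x)\<^sup>2 \<le> x \<bullet> T x" by (simp add: zero)
    qed simp
  next
    case False
    have "compact K" unfolding K_def using S by (intro closed_Int_compact closed_subspace compact_sphere)
    moreover have "continuous_on K (\<lambda>x. x \<bullet> T x)"
      by (intro continuous_on_inner continuous_on_id bounded_linear.continuous_on[OF T])
    ultimately obtain m where m: "m \<in> K" "\<And>u. u \<in> K \<Longrightarrow> m \<bullet> T m \<le> u \<bullet> T u"
      using continuous_attains_inf[of K "\<lambda>x. x \<bullet> T x"] False by blast
    show ?thesis
    proof (rule that)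
      show "0 < m \<bullet> T m" using m(1) by (intro pos) (auto simp: K_def)
      fix x assume "x \<in> S"
      show "(m \<bullet> T m) * (norm x)\<^sup>2 \<le> x \<bullet> T x"
      proof (cases "x = 0")
        case False
        have "m \<bullet> T m \<le> (1 / norm x) *\<^sub>R x \<bullet> T ((1 / norm x) *\<^sub>R x)"
          by (rule m(2)[OF unit[OF \<open>x \<in> S\<close> False]])
        also have "\<dots> = (x \<bullet> T x) / (norm x)\<^sup>2" by (simp add: scaleR power2_eq_square)
        finally show ?thesis using False by (simp add: field_simps)
      qed (simp add: zero)
    qed
  qed
qed

text \<open>First-order optimality of the nearest consensus state: moving it along Cayley curves shows
  that the deviation has no component along the consensus directions.\<close>

lemma nearest_consensus:
  fixes Q :: "real^'n^'n^'k"
  assumes Q: "Q \<in> SO_pow"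
  obtains R H where "R \<in> SO" "H = (\<chi> i. Q $ i ** transpose R - mat 1)"
    "infdist Q C_s = norm H" "(\<Sum>i\<in>UNIV. skew (H $ i)) = 0"
proof -
  obtain X where X: "X \<in> C_s" "infdist Q C_s = dist Q X"
    using infdist_attains_inf[OF compact_imp_closed[OF compact_C_s] C_s_nonempty] by blast
  then obtain R where R: "R \<in> SO" and XR: "X = (\<chi> i. R)" unfolding C_s_eq by blast
  define H where "H = (\<chi> i. Q $ i ** transpose R - mat 1)"
  \<comment> \<open>Right multiplication by \<open>R\<close> is an isometry, so comparing
    \<open>Q\<close> with the consensus state of \<open>T ** R\<close> amounts to comparing
    \<open>H\<close> with \<open>T - mat 1\<close>.\<close>
  have shift: "dist Q (\<chi> i. T ** R) = norm (H - (\<chi> i. T - mat 1))" for T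
  proof -
    have "norm (Q $ i - T ** R) = norm (H $ i - (T - mat 1))" for i
    proof -
      have "Q $ i - T ** R = (H $ i - (T - mat 1)) ** R"
        using R by (simp add: H_def matrix_mult_linear SO_transpose_mult flip: matrix_mul_assoc)
      then show ?thesis by (simp add: norm_SO_mult_right[OF R])
    qed
    then show ?thesis unfolding dist_norm norm_vec_def[of "Q - _"] norm_vec_def[of "H - _"] by simp
  qed
  have dH: "infdist Q C_s = norm H" using shift[of "mat 1"] X(2) XR by (simp add: zero_vec_def[symmetric])
  define N where "N = (\<Sum>i\<in>UNIV. H $ i)"
  define S where "S = skew N"
  have "S \<in> so" unfolding S_def by (rule skew_in_so)
  \<comment> \<open>The competitor moves along \<open>S\<close>, the skew part of \<open>N\<close>
    itself, so \<open>D\<close> is \<open>(2 * t) *\<^sub>R S\<close> up to order two. In the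
    optimality condition \<open>2 * (N \<bullet> D) \<le> CARD('k) * (norm D)\<^sup>2\<close> the
    left side is \<open>4 * t * (norm S)\<^sup>2\<close> to first order, the right side of order
    \<open>t\<^sup>2\<close>.\<close>
  have "4 * (norm S)\<^sup>2 \<le> 0"
  proof (rule linear_le_quadratic_imp_nonpos[OF zero_less_one])
    fix t :: real assume t: "0 < t" "t < 1"
    have "t *\<^sub>R S \<in> so" using \<open>S \<in> so\<close> subspace_so subspace_scale by blast
    then obtain T where T: "T \<in> SO" "T = mat 1 + t *\<^sub>R S + (t *\<^sub>R S) ** T" by (rule cayley_transform)
    note est = cayley_estimates[OF T]
    define D where "D = T - mat 1"
    define c :: "real^'n^'n^'k" where "c = (\<chi> i. D)"
    have "(\<chi> i. T ** R) \<in> C_s" unfolding C_s_eq using mult_in_SO[OF T(1) R] by blast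
    then have "norm H \<le> norm (H - c)"
      using infdist_le[of _ C_s Q] unfolding dH[symmetric] c_def D_def shift[symmetric] by blast
    then have "H \<bullet> H \<le> (H - c) \<bullet> (H - c)" by (simp add: norm_le)
    then have "2 * (H \<bullet> c) \<le> c \<bullet> c" by (simp add: inner_diff_left inner_diff_right inner_commute)
    moreover have "H \<bullet> c = N \<bullet> D" by (simp add: inner_vec_def[of H] c_def N_def inner_sum_left)
    moreover have "c \<bullet> c = CARD('k) * (norm D)\<^sup>2"
      unfolding inner_vec_def[of c] by (simp add: c_def power2_norm_eq_inner)
    ultimately have 1: "2 * (N \<bullet> D) \<le> CARD('k) * (norm D)\<^sup>2" by simp
    have "(norm D)\<^sup>2 \<le> (2 * (t * norm S))\<^sup>2"
      using est(1) t by (intro power_mono) (simp_all add: D_def)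
    then have 2: "CARD('k) * (norm D)\<^sup>2 \<le> CARD('k) * (4 * t\<^sup>2 * (norm S)\<^sup>2)"
      by (intro mult_left_mono) (simp_all add: power_mult_distrib)
    have NS: "N \<bullet> S = (norm S)\<^sup>2" using inner_skew_eq_norm[of N] by (simp add: S_def)
    have "2 * t * (norm S)\<^sup>2 - N \<bullet> D = (- N) \<bullet> (D - 2 *\<^sub>R (t *\<^sub>R S))"
      by (simp add: inner_diff_right NS)
    also have "\<dots> \<le> norm (- N) * norm (D - 2 *\<^sub>R (t *\<^sub>R S))" by (rule norm_cauchy_schwarz)
    also have "\<dots> \<le> norm (- N) * (2 * (norm (t *\<^sub>R S))\<^sup>2)"
      using est(2) by (intro mult_left_mono) (simp_all add: D_def)
    also have "\<dots> = 2 * norm N * (norm S)\<^sup>2 * t\<^sup>2" by (simp add: power_mult_distrib)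
    finally show "4 * (norm S)\<^sup>2 * t \<le> (4 * norm N * (norm S)\<^sup>2 + 4 * CARD('k) * (norm S)\<^sup>2) * t\<^sup>2"
      using order_trans[OF 1 2] by (simp add: algebra_simps)
  qed
  then have "S = 0" by simp
  then have "(\<Sum>i\<in>UNIV. skew (H $ i)) = 0"
    by (simp add: S_def N_def linear_sum[OF bounded_linear.linear[OF bounded_linear_skew]])
  then show ?thesis using that R H_def dH by blast
qed

text \<open>Orthogonality of \<open>mat 1 + H\<close> says that \<open>H + transpose H\<close>,
  twice the symmetric part, equals \<open>- (transpose H ** H)\<close>.\<close>

lemma symmetric_part_SO_le:
  assumes "mat 1 + H \<in> SO" shows "norm (H - skew H) \<le> 1 / 2 * (norm H)\<^sup>2"
proof -
  have "transpose (mat 1 + H) ** (mat 1 + H) = mat 1" using assms by (rule SO_transpose_mult)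
  then have "H + transpose H = - (transpose H ** H)"
    by (simp add: transpose_linear transpose_mat matrix_mult_linear eq_neg_iff_add_eq_0 algebra_simps)
  moreover have "H - skew H = (1 / 2) *\<^sub>R (H + transpose H)"
    by (simp add: skew_def vec_eq_iff field_simps)
  ultimately have "H - skew H = - (1 / 2) *\<^sub>R (transpose H ** H)" by simp
  then have "norm (H - skew H) = 1 / 2 * norm (transpose H ** H)" by simp
  also have "\<dots> \<le> 1 / 2 * (norm (transpose H) * norm H)" by (intro mult_left_mono norm_matrix_mult_le) simp
  finally show ?thesis by (simp add: norm_transpose power2_eq_square)
qed

context reference_graph begin

text \<open>A consensus tuple summing to zero vanishes, so under the kernel condition the
  semidefinite form is definite on this subspace.\<close>

lemma lap_coercive:
  assumes consensus_kernel
  obtains l where "0 < l"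
    "\<And>W. W \<in> so_pow \<Longrightarrow> (\<Sum>i\<in>UNIV. W $ i) = 0 \<Longrightarrow> l * (norm W)\<^sup>2 \<le> W \<bullet> lap W"
proof -
  define S where "S = {W :: real^'n^'n^'k. W \<in> so_pow \<and> (\<Sum>i\<in>UNIV. W $ i) = 0}"
  have "subspace S"
    using subspace_so
    by (auto simp: S_def so_pow_def subspace_def sum.distrib scaleR_sum_right[symmetric])
  moreover have "0 < W \<bullet> lap W" if W: "W \<in> S" "W \<noteq> 0" for W
  proof -
    have "W \<bullet> lap W \<noteq> 0"
    proof
      assume "W \<bullet> lap W = 0"
      then have eq: "W $ i = W $ j" for i j
        using assms W unfolding consensus_kernel_def S_def lap_eq_0_iff_inner[symmetric] by blast
      have "W $ i = 0" for i
      proof -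
        have "(\<Sum>j\<in>UNIV. W $ j) = (\<Sum>j\<in>(UNIV :: 'k set). W $ i)" by (intro sum.cong refl eq)
        then have "real CARD('k) *\<^sub>R W $ i = 0"
          using W(1) unfolding sum_constant_scaleR S_def by auto
        moreover have "real CARD('k) \<noteq> 0" by simp
        ultimately show ?thesis unfolding scaleR_eq_0_iff by blast
      qed
      then show False using W(2) by (simp add: vec_eq_iff)
    qed
    then show ?thesis using lap_nonneg[of W] by simp
  qed
  ultimately obtain l where "0 < l" "\<And>x. x \<in> S \<Longrightarrow> l * (norm x)\<^sup>2 \<le> x \<bullet> lap x"
    using coercive_on_subspace[OF bounded_linear_lap] by metis
  then show ?thesis using that by (auto simp: S_def)
qed

text \<open>The deviation \<open>H\<close> from the nearest state splits into its skew part
  \<open>W\<close>, where the form is coercive, and a symmetric part \<open>Z\<close> of quadratic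
  size. The two lower bounds are obtained on \<open>W\<close> and corrected by
  \<open>Z\<close>.\<close>

lemma local_estimates:
  assumes consensus_kernel
  obtains r c C where "0 < r" "0 < c" "0 < C"
    "\<And>Q. Q \<in> SO_pow \<Longrightarrow> infdist Q C_s \<le> r \<Longrightarrow> c * (infdist Q C_s)\<^sup>2 \<le> Q \<bullet> lap Q"
    "\<And>Q. Q \<in> SO_pow \<Longrightarrow> infdist Q C_s \<le> r \<Longrightarrow> Q \<bullet> lap Q \<le> C * (infdist Q C_s)\<^sup>2"
    "\<And>Q. Q \<in> SO_pow \<Longrightarrow> infdist Q C_s \<le> r \<Longrightarrow> c * (infdist Q C_s)\<^sup>2 \<le> (norm (dynamics E y Q))\<^sup>2"
proof -
  obtain l where l: "0 < l"
    "\<And>W. W \<in> so_pow \<Longrightarrow> (\<Sum>i\<in>UNIV. W $ i) = 0 \<Longrightarrow> l * (norm W)\<^sup>2 \<le> W \<bullet> lap W"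
    using lap_coercive[OF assms] by blast
  obtain K where K: "0 < K" "\<And>X. norm (lap X) \<le> norm X * K"
    using bounded_linear.pos_bounded[OF bounded_linear_lap] by blast
  have lap_cs: "\<bar>X \<bullet> lap Y\<bar> \<le> K * (norm X * norm Y)" for X Y
  proof -
    have "\<bar>X \<bullet> lap Y\<bar> \<le> norm X * norm (lap Y)" by (rule Cauchy_Schwarz_ineq2)
    also have "\<dots> \<le> norm X * (norm Y * K)" by (intro mult_left_mono K) simp
    finally show ?thesis by (simp add: mult_ac)
  qed
  \<comment> \<open>Every higher-order error has a coefficient of at most \<open>l + 2 * K\<close>;
    within this radius it costs at most half of the leading \<open>l\<close>.\<close>
  define r where "r = l / (2 * (l + 2 * K))"
  define c where "c = min (l / 2) ((l / 2)\<^sup>2)"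
  have r: "0 < r" "r \<le> 1 / 2" and c: "0 < c" using l(1) K(1) by (auto simp: r_def c_def field_simps)
  have est: "l / 2 * (infdist Q C_s)\<^sup>2 \<le> Q \<bullet> lap Q \<and> Q \<bullet> lap Q \<le> K * (infdist Q C_s)\<^sup>2 \<and>
      l / 2 * infdist Q C_s \<le> norm (dynamics E y Q)"
    if Q: "Q \<in> SO_pow" and near: "infdist Q C_s \<le> r" for Q
  proof -
    obtain R H where R: "R \<in> SO" and H: "H = (\<chi> i. Q $ i ** transpose R - mat 1)"
      and dH: "infdist Q C_s = norm H" and sum0: "(\<Sum>i\<in>UNIV. skew (H $ i)) = 0"
      using nearest_consensus[OF Q] by blast
    define I :: "real^'n^'n^'k" where "I = (\<chi> i. mat 1)"
    define W where "W = tuple_skew H"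
    define Z where "Z = H - W"
    have HWZ: "H = W + Z" by (simp add: Z_def)
    have P: "(\<chi> i. Q $ i ** transpose R) = H + I" by (simp add: H I_def vec_eq_iff)
    have "lap I = 0" by (rule lap_consensus) (simp add: I_def)
    then have lapP: "lap Q $ i ** transpose R = lap H $ i" for i
      using lap_mult_right[of Q "transpose R" i] by (simp add: P lap_linear)
    have W: "W \<in> so_pow" by (simp add: W_def tuple_skew_in_so_pow)
    have coer: "l * (norm W)\<^sup>2 \<le> W \<bullet> lap W"
      using sum0 by (intro l W) (simp add: W_def tuple_skew_def)
    have normZ: "norm Z \<le> 1 / 2 * (norm H * norm H)"
    proof (rule norm_vec_le_mult)
      fix i
      have "mat 1 + H $ i \<in> SO"
        using Q R by (simp add: H SO_pow_def mult_in_SO transpose_in_SO)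
      from symmetric_part_SO_le[OF this]
      show "norm (Z $ i) \<le> 1 / 2 * (norm (H $ i) * norm (H $ i))"
        by (simp add: Z_def W_def tuple_skew_def power2_eq_square)
    qed simp
    have WH: "norm W \<le> norm H" unfolding W_def by (rule norm_tuple_skew_le)
    have HW: "norm H - 1 / 2 * (norm H)\<^sup>2 \<le> norm W"
      using norm_triangle_ineq[of W Z] normZ by (simp add: HWZ[symmetric] power2_eq_square)
    define h where "h = norm H"
    have h: "0 \<le> h" "h \<le> r" "h \<le> 1 / 2" using near r dH by (auto simp: h_def)
    have hl: "h * (2 * (l + 2 * K)) \<le> l"
      using h(2) l(1) K(1) by (simp add: r_def field_simps)
    have ZW: "\<bar>Z \<bullet> lap W\<bar> \<le> K * (1 / 2 * h\<^sup>2 * norm W)"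
    proof -
      have "norm Z * norm W \<le> 1 / 2 * h\<^sup>2 * norm W"
        using normZ by (intro mult_right_mono) (simp_all add: h_def power2_eq_square)
      then have "K * (norm Z * norm W) \<le> K * (1 / 2 * h\<^sup>2 * norm W)" using K(1) by (intro mult_left_mono) auto
      then show ?thesis using lap_cs[of Z W] by linarith
    qed
    \<comment> \<open>Right rotation leaves the energy unchanged and \<open>lap I = 0\<close>, so
      the form in \<open>H\<close> is exact.\<close>
    have e_eq: "Q \<bullet> lap Q = H \<bullet> lap H"
    proof -
      have "Q \<bullet> lap Q = (\<Sum>i\<in>UNIV. (Q $ i ** transpose R) \<bullet> (lap Q $ i ** transpose R))"
        using R by (simp add: inner_vec_def[of Q] inner_matrix_mult_right SO_transpose_mult flip: matrix_mul_assoc)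
      also have "\<dots> = (H + I) \<bullet> lap H" unfolding P[symmetric] inner_vec_def[of "\<chi> i. Q $ i ** transpose R"] lapP by simp
      also have "\<dots> = H \<bullet> lap H" using \<open>lap I = 0\<close> by (simp add: inner_add_left lap_selfadjoint[of I])
      finally show ?thesis .
    qed
    \<comment> \<open>The cross term costs at most \<open>K * h\<^sup>2 * norm W\<close>, the term
      in \<open>Z\<close> alone is nonnegative, and \<open>norm W\<close> is at least
      \<open>h - 1 / 2 * h\<^sup>2\<close>.\<close>
    have lower: "l / 2 * h\<^sup>2 \<le> H \<bullet> lap H"
    proof -
      have "H \<bullet> lap H = W \<bullet> lap W + 2 * (Z \<bullet> lap W) + Z \<bullet> lap Z"
        unfolding HWZ by (simp add: lap_linear inner_add_left inner_add_right lap_selfadjoint[of W Z] inner_commute[of "lap W" Z])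
      then have "l * (norm W)\<^sup>2 - K * (h\<^sup>2 * norm W) \<le> H \<bullet> lap H"
        using coer ZW lap_nonneg[of Z] by simp
      moreover have "K * (h\<^sup>2 * norm W) \<le> K * (h\<^sup>2 * h)"
        using K(1) WH by (intro mult_left_mono) (auto simp: h_def)
      moreover have "h\<^sup>2 * (1 - h) \<le> (norm W)\<^sup>2"
      proof -
        have "h\<^sup>2 * (1 - h) \<le> (h - 1 / 2 * h\<^sup>2)\<^sup>2" using h(1) by (simp add: power2_eq_square algebra_simps)
        also have "\<dots> \<le> (norm W)\<^sup>2"
        proof (rule power_mono)
          show "h - 1 / 2 * h\<^sup>2 \<le> norm W" using HW by (simp add: h_def)
          have "h * h \<le> 1 * h" using h by (intro mult_right_mono) auto
          then show "0 \<le> h - 1 / 2 * h\<^sup>2" using h(1) unfolding power2_eq_square by linarith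
        qed
        finally show ?thesis .
      qed
      then have "l * (h\<^sup>2 * (1 - h)) \<le> l * (norm W)\<^sup>2" using l(1) by (intro mult_left_mono) auto
      moreover have "h\<^sup>2 * (h * (2 * (l + 2 * K))) \<le> h\<^sup>2 * l" by (intro mult_left_mono hl) simp
      moreover have "0 \<le> h\<^sup>2 * h * K" using h K by simp
      ultimately show ?thesis by (simp add: algebra_simps)
    qed
    \<comment> \<open>The projected gradient is tested against \<open>X\<close>, the direction
      \<open>W\<close> in the frame of \<open>R\<close>. The errors are 1/2 from
      \<open>Z \<bullet> lap W\<close> and 1 from \<open>tuple_mult H W \<bullet> lap H\<close>, in
      units of \<open>K * h\<^sup>2 * norm W\<close>. The factor \<open>norm W\<close> is cancelled
      afterwards.\<close>
    have "norm (dynamics E y Q) * norm W \<ge> (l * norm W - 3 / 2 * K * h\<^sup>2) * norm W"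
    proof -
      define X :: "real^'n^'n^'k" where "X = (\<chi> i. transpose R ** W $ i ** R)"
      let ?G = "tuple_mult (tuple_transpose Q) (lap Q)"
      have X: "X \<in> so_pow" using W by (simp add: X_def so_pow_def so_conj)
      have normX: "norm X = norm W"
        unfolding norm_vec_def[of X] norm_vec_def[of W]
        by (simp add: X_def norm_SO_mult_right[OF R] norm_SO_mult_left[OF transpose_in_SO[OF R]])
      have entry: "?G $ i \<bullet> X $ i = lap H $ i \<bullet> (W + tuple_mult H W) $ i" for i
      proof -
        have "?G $ i \<bullet> X $ i = (lap Q $ i ** transpose R) \<bullet> (Q $ i ** transpose R ** W $ i)"
          by (simp add: tuple_mult_def tuple_transpose_def X_def matrix_mul_assoc
              inner_matrix_mult_left[of "transpose (Q $ i)" "lap Q $ i"] inner_matrix_mult_right[of "lap Q $ i" "transpose R"])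
        also have "\<dots> = lap H $ i \<bullet> (W + tuple_mult H W) $ i"
          unfolding lapP by (simp add: H tuple_mult_def matrix_mult_linear)
        finally show ?thesis .
      qed
      have "tuple_skew ?G \<bullet> X = ?G \<bullet> X"
        using inner_tuple_skew[OF X, of ?G] by (simp only: inner_commute)
      also have "\<dots> = lap H \<bullet> (W + tuple_mult H W)"
        unfolding inner_vec_def[of ?G] inner_vec_def[of "lap H"] entry ..
      also have "\<dots> = W \<bullet> lap W + Z \<bullet> lap W + tuple_mult H W \<bullet> lap H"
        unfolding inner_add_right inner_commute[of "lap H"]
        by (simp add: HWZ lap_linear inner_add_right lap_selfadjoint[of W Z] inner_commute[of "lap W" Z])
      finally have eq: "tuple_skew ?G \<bullet> X = W \<bullet> lap W + Z \<bullet> lap W + tuple_mult H W \<bullet> lap H" .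
      have "\<bar>tuple_mult H W \<bullet> lap H\<bar> \<le> K * (norm (tuple_mult H W) * h)" unfolding h_def by (rule lap_cs)
      also have "\<dots> \<le> K * ((h * norm W) * h)"
        using K(1) h norm_tuple_mult_le[of H W] by (intro mult_left_mono mult_right_mono) (auto simp: h_def)
      finally have "l * (norm W)\<^sup>2 - 3 / 2 * K * h\<^sup>2 * norm W \<le> tuple_skew ?G \<bullet> X"
        unfolding eq using coer ZW by (simp add: power2_eq_square algebra_simps)
      also have "\<dots> \<le> norm (tuple_skew ?G) * norm X" by (rule norm_cauchy_schwarz)
      finally show ?thesis by (simp add: normX norm_dynamics[OF Q] power2_eq_square algebra_simps)
    qed
    then have "norm (dynamics E y Q) \<ge> l * norm W - 3 / 2 * K * h\<^sup>2"
    proof (cases "W = 0")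
      case True
      then show ?thesis
        using K(1) by (intro order_trans[OF _ norm_ge_zero]) (simp add: mult_nonneg_nonneg)
    qed simp
    moreover have "l * (h - 1 / 2 * h\<^sup>2) \<le> l * norm W" using HW l(1) by (intro mult_left_mono) (auto simp: h_def)
    moreover have "h * (h * (2 * (l + 2 * K))) \<le> h * l" by (intro mult_left_mono hl h)
    moreover have "0 \<le> h\<^sup>2 * l" "0 \<le> h\<^sup>2 * K" using l K by auto
    ultimately have "l / 2 * h \<le> norm (dynamics E y Q)"
      by (simp add: power2_eq_square algebra_simps)
    moreover have "H \<bullet> lap H \<le> K * h\<^sup>2" using lap_cs[of H H] by (simp add: h_def power2_eq_square)
    ultimately show ?thesis using lower by (simp add: e_eq dH h_def)
  qed
  show ?thesis
  proof (rule that[OF r(1) c K(1)])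
    fix Q :: "real^'n^'n^'k" assume Q: "Q \<in> SO_pow" "infdist Q C_s \<le> r"
    note est = est[OF Q]
    have "c * (infdist Q C_s)\<^sup>2 \<le> l / 2 * (infdist Q C_s)\<^sup>2" by (intro mult_right_mono) (simp_all add: c_def)
    then show "c * (infdist Q C_s)\<^sup>2 \<le> Q \<bullet> lap Q" using est by linarith
    show "Q \<bullet> lap Q \<le> K * (infdist Q C_s)\<^sup>2" using est by blast
    have "c * (infdist Q C_s)\<^sup>2 \<le> (l / 2)\<^sup>2 * (infdist Q C_s)\<^sup>2" by (intro mult_right_mono) (simp_all add: c_def)
    also have "\<dots> = (l / 2 * infdist Q C_s)\<^sup>2" by (simp only: power_mult_distrib)
    also have "\<dots> \<le> (norm (dynamics E y Q))\<^sup>2"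
      using est l(1) by (intro power_mono) (auto intro!: mult_nonneg_nonneg infdist_nonneg)
    finally show "c * (infdist Q C_s)\<^sup>2 \<le> (norm (dynamics E y Q))\<^sup>2" .
  qed
qed

lemma stable_if_consensus_kernel:
  assumes consensus_kernel
  shows "locally_exponentially_stable (dynamics E y) SO_pow C_s"
proof (rule local_estimates[OF assms])
  fix r c C :: real
  assume "0 < r" "0 < c" "0 < C"
    and est: "\<And>Q. Q \<in> SO_pow \<Longrightarrow> infdist Q C_s \<le> r \<Longrightarrow> c * (infdist Q C_s)\<^sup>2 \<le> Q \<bullet> lap Q"
    "\<And>Q. Q \<in> SO_pow \<Longrightarrow> infdist Q C_s \<le> r \<Longrightarrow> Q \<bullet> lap Q \<le> C * (infdist Q C_s)\<^sup>2"
    "\<And>Q. Q \<in> SO_pow \<Longrightarrow> infdist Q C_s \<le> r \<Longrightarrow> c * (infdist Q C_s)\<^sup>2 \<le> (norm (dynamics E y Q))\<^sup>2"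
  show ?thesis
    by (rule exponential_stability_of_gradient_flow[OF energy_deriv \<open>0 < r\<close> \<open>0 < c\<close> \<open>0 < C\<close> est])
qed

end

subsection \<open>Necessity of the kernel condition\<close>

text \<open>Both components lie within \<open>infdist P C_s\<close> of the common rotation of the
  nearest state. A first-order disagreement thus forces a first-order distance.\<close>

lemma norm_diff_le_infdist_C_s:
  "norm (P $ a - P $ b) \<le> 2 * infdist P C_s" for P :: "real^'n^'n^'k"
proof -
  obtain X where X: "X \<in> C_s" "infdist P C_s = dist P X"
    using infdist_attains_inf[OF compact_imp_closed[OF compact_C_s] C_s_nonempty] by blast
  then obtain R where XR: "X = (\<chi> i. R)" unfolding C_s_eq by blast
  have "norm (P $ i - R) \<le> dist P X" for i
    using Finite_Cartesian_Product.norm_nth_le[of "P - X" i] by (simp add: XR dist_norm)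
  then show ?thesis
    using norm_triangle_ineq4[of "P $ a - R" "P $ b - R"] X(2)
    by (smt (verit) diff_diff_eq2 diff_add_cancel)
qed

context reference_graph begin

text \<open>Along a kernel direction that is not consensus the energy starts at order four in the
  displacement, so by the energy identity the flow moves by at most order two in any fixed time,
  which rules out a contraction of the first-order distance to consensus.\<close>

lemma consensus_kernel_if_stable:
  assumes "locally_exponentially_stable (dynamics E y) SO_pow C_s"
  shows consensus_kernel
  unfolding consensus_kernel_def
proof (intro ballI impI allI)
  fix W :: "real^'n^'n^'k" and a b
  assume W: "W \<in> so_pow" and lapW: "lap W = 0"
  obtain \<delta> \<alpha> \<beta> where pos: "0 < \<delta>" "0 < \<alpha>" "0 < \<beta>"
    and stable: "\<And>Q t. is_solution (dynamics E y) SO_pow Q \<Longrightarrow> infdist (Q 0) C_s < \<delta> \<Longrightarrow> 0 \<le> t \<Longrightarrow>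
      infdist (Q t) C_s \<le> \<alpha> * exp (- \<beta> * t) * infdist (Q 0) C_s"
    using assms unfolding locally_exponentially_stable_def by metis
  \<comment> \<open>With \<open>\<beta> * T = 2 * \<alpha>\<close>, the bound exp x \<ge> 1 + x
    already shows that the distance has halved by time \<open>T\<close>.\<close>
  define T where "T = 2 * \<alpha> / \<beta>"
  have T: "0 < T" using pos by (simp add: T_def)
  have half: "\<alpha> * exp (- \<beta> * T) \<le> 1 / 2"
  proof -
    have "\<beta> * T = 2 * \<alpha>" using pos by (simp add: T_def)
    then have "2 * \<alpha> \<le> exp (\<beta> * T)" using exp_ge_add_one_self[of "\<beta> * T"] by linarith
    then show ?thesis by (simp add: exp_minus field_simps)
  qed
  obtain K where K: "0 < K" "\<And>X. norm (lap X) \<le> norm X * K"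
    using bounded_linear.pos_bounded[OF bounded_linear_lap] by blast
  define w where "w = norm W"
  define I :: "real^'n^'n^'k" where "I = (\<chi> i. mat 1)"
  have "lap I = 0" by (rule lap_consensus) (simp add: I_def)
  have "norm (W $ a - W $ b) \<le> 0"
  proof (rule linear_le_quadratic_imp_nonpos)
    \<comment> \<open>The Cayley point is at most \<open>2 * \<epsilon> * w\<close> from the
      identity, so this range keeps it within \<open>\<delta>\<close>; the 1 covers
      \<open>W = 0\<close>.\<close>
    show "0 < \<delta> / (2 * w + 1)" using pos by (simp add: w_def add_nonneg_pos)
    fix \<epsilon> assume \<epsilon>: "0 < \<epsilon>" "\<epsilon> < \<delta> / (2 * w + 1)"
    have "\<exists>R. R \<in> SO \<and> R = mat 1 + \<epsilon> *\<^sub>R W $ i + (\<epsilon> *\<^sub>R W $ i) ** R" for i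
    proof -
      have "\<epsilon> *\<^sub>R W $ i \<in> so" using W subspace_scale[OF subspace_so] by (auto simp: so_pow_def)
      then show ?thesis using cayley_transform by metis
    qed
    then obtain R where R: "\<And>i. R i \<in> SO" "\<And>i. R i = mat 1 + \<epsilon> *\<^sub>R W $ i + (\<epsilon> *\<^sub>R W $ i) ** R i"
      by metis
    define P where "P = (\<chi> i. R i)"
    define Z where "Z = P - I - (2 * \<epsilon>) *\<^sub>R W"
    have P: "P \<in> SO_pow" using R(1) by (simp add: P_def SO_pow_def)
    have "norm Z \<le> 2 * \<epsilon>\<^sup>2 * (norm W * norm W)"
    proof (rule norm_vec_le_mult)
      fix i
      show "norm (Z $ i) \<le> 2 * \<epsilon>\<^sup>2 * (norm (W $ i) * norm (W $ i))"
        using cayley_estimates(2)[OF R(1,2)[of i]] \<epsilon>(1)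
        by (simp add: Z_def P_def I_def power_mult_distrib power2_eq_square mult_ac)
    qed simp
    then have Z: "norm Z \<le> 2 * \<epsilon>\<^sup>2 * w\<^sup>2" by (simp add: w_def power2_eq_square)
    have "norm (P - I) \<le> norm ((2 * \<epsilon>) *\<^sub>R W)"
    proof (rule norm_le_componentwise_cart)
      fix i show "norm ((P - I) $ i) \<le> norm (((2 * \<epsilon>) *\<^sub>R W) $ i)"
        using cayley_estimates(1)[OF R(1,2)[of i]] \<epsilon>(1) by (simp add: P_def I_def)
    qed
    also have "\<dots> \<le> \<epsilon> * (2 * w + 1)" using \<epsilon>(1) by (simp add: w_def algebra_simps)
    also have "\<dots> < \<delta>" using \<epsilon>(2) by (simp add: w_def pos_less_divide_eq add_nonneg_pos)
    finally have "dist P I < \<delta>" by (simp add: dist_norm)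
    moreover have "I \<in> C_s" unfolding C_s_eq I_def using mat_1_in_SO by blast
    ultimately have near: "infdist P C_s < \<delta>" using infdist_le[of I C_s P] by simp
    \<comment> \<open>\<open>lap\<close> kills both \<open>I\<close> and \<open>W\<close>, so the
      energy sees only the quadratic remainder \<open>Z\<close>.\<close>
    have energy: "P \<bullet> lap P \<le> 4 * K * \<epsilon>^4 * w^4"
    proof -
      have PZ: "P = Z + I + (2 * \<epsilon>) *\<^sub>R W" by (simp add: Z_def)
      have lapP: "lap P = lap Z" unfolding PZ by (simp add: lap_linear lapW \<open>lap I = 0\<close>)
      have "P \<bullet> lap P = lap Z \<bullet> Z" by (simp add: lap_selfadjoint[of P P] lapP)
         (metis lapP lap_selfadjoint)
      also have "\<dots> \<le> norm (lap Z) * norm Z" by (rule norm_cauchy_schwarz)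
      also have "\<dots> \<le> (norm Z * K) * norm Z" by (intro mult_right_mono K) simp
      also have "\<dots> = K * (norm Z)\<^sup>2" by (simp add: power2_eq_square)
      also have "\<dots> \<le> K * (2 * \<epsilon>\<^sup>2 * w\<^sup>2)\<^sup>2" using K(1) by (intro mult_left_mono power_mono Z) auto
      finally show ?thesis by (simp add: power_mult_distrib flip: power_mult)
    qed
    obtain Q where Q: "is_solution (dynamics E y) SO_pow Q" and Q0: "Q 0 = P"
      using dynamics_solution_exists[OF P] by blast
    have dQ: "(Q has_vector_derivative dynamics E y (Q t)) (at t within {0..})" if "0 \<le> t" for t
      using Q that by (simp add: is_solution_def)
    let ?e = "\<lambda>t. Q t \<bullet> lap (Q t)"
    \<comment> \<open>By Young's inequality the speed is at most
      \<open>\<epsilon>\<^sup>2 / 2\<close> plus its square over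
      \<open>2 * \<epsilon>\<^sup>2\<close>, which by the energy identity is the derivative of
      \<open>\<phi>\<close>. The weight \<open>\<epsilon>\<^sup>2\<close> balances the two
      contributions: with energy of order four, both are of order two.\<close>
    define \<phi> where "\<phi> t = \<epsilon>\<^sup>2 / 2 * t - 1 / (4 * \<epsilon>\<^sup>2) * ?e t" for t
    have d\<phi>: "(\<phi> has_vector_derivative \<epsilon>\<^sup>2 / 2 + (norm (dynamics E y (Q t)))\<^sup>2 / (2 * \<epsilon>\<^sup>2)) (at t within {0..})"
      if "0 \<le> t" for t
    proof -
      have "(\<phi> has_vector_derivative
          \<epsilon>\<^sup>2 / 2 - 1 / (4 * \<epsilon>\<^sup>2) * (- 2 * (norm (dynamics E y (Q t)))\<^sup>2)) (at t within {0..})"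
        using energy_deriv[OF Q that] unfolding \<phi>_def has_real_derivative_iff_has_vector_derivative[symmetric]
        by (intro DERIV_diff DERIV_cmult) (auto intro!: derivative_eq_intros)
      then show ?thesis by simp
    qed
    have "norm (Q T - Q 0) \<le> \<phi> T - \<phi> 0"
    proof (rule differentiable_bound_general[OF T])
      show "continuous_on {0..T} Q" "continuous_on {0..T} \<phi>"
        by (rule continuous_on_subset[of "{0..}"];
            auto simp: continuous_on_eq_continuous_within intro: has_vector_derivative_continuous dQ d\<phi>)+
      fix t assume t: "0 < t" "t < T"
      show "(Q has_vector_derivative dynamics E y (Q t)) (at t)"
        "(\<phi> has_vector_derivative \<epsilon>\<^sup>2 / 2 + (norm (dynamics E y (Q t)))\<^sup>2 / (2 * \<epsilon>\<^sup>2)) (at t)"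
        using t by (auto intro!: has_vector_derivative_imp_at dQ d\<phi>)
      have "0 \<le> (norm (dynamics E y (Q t)) - \<epsilon>\<^sup>2)\<^sup>2" by simp
      then show "norm (dynamics E y (Q t)) \<le> \<epsilon>\<^sup>2 / 2 + (norm (dynamics E y (Q t)))\<^sup>2 / (2 * \<epsilon>\<^sup>2)"
        using \<epsilon>(1) by (simp add: power2_diff field_simps flip: power2_eq_square)
    qed
    also have "\<dots> \<le> \<epsilon>\<^sup>2 / 2 * T + ?e 0 / (4 * \<epsilon>\<^sup>2)"
      using lap_nonneg[of "Q T"] by (simp add: \<phi>_def)
    also have "\<dots> \<le> \<epsilon>\<^sup>2 / 2 * T + 4 * K * \<epsilon>^4 * w^4 / (4 * \<epsilon>\<^sup>2)"
      using energy by (intro add_left_mono divide_right_mono) (simp_all add: Q0)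
    also have "\<dots> = \<epsilon>\<^sup>2 * (T / 2 + K * w^4)"
      using \<epsilon>(1) by (simp add: field_simps power2_eq_square power4_eq_xxxx)
    finally have moved: "dist P (Q T) \<le> \<epsilon>\<^sup>2 * (T / 2 + K * w^4)"
      by (simp add: Q0 dist_norm norm_minus_commute)
    have "infdist (Q T) C_s \<le> \<alpha> * exp (- \<beta> * T) * infdist P C_s"
      using stable[OF Q, of T] near T by (simp add: Q0)
    also have "\<dots> \<le> 1 / 2 * infdist P C_s" by (intro mult_right_mono half infdist_nonneg)
    \<comment> \<open>The distance of \<open>P\<close> is at most the displacement plus half of
      itself.\<close>
    finally have "infdist P C_s \<le> 2 * dist P (Q T)"
      using infdist_triangle[of P C_s "Q T"] by simp
    then have "norm (P $ a - P $ b) \<le> 4 * (\<epsilon>\<^sup>2 * (T / 2 + K * w^4))"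
      using moved norm_diff_le_infdist_C_s[of P a b] by simp
    moreover have "2 * \<epsilon> * norm (W $ a - W $ b) \<le> norm (P $ a - P $ b) + 2 * norm Z"
    proof -
      have "(2 * \<epsilon>) *\<^sub>R (W $ a - W $ b) = (P $ a - P $ b) + (Z $ b - Z $ a)"
        by (simp add: Z_def I_def algebra_simps)
      then have "norm ((2 * \<epsilon>) *\<^sub>R (W $ a - W $ b)) \<le> norm (P $ a - P $ b) + norm (Z $ b - Z $ a)"
        by (metis norm_triangle_ineq)
      moreover have "norm (Z $ b - Z $ a) \<le> norm Z + norm Z"
        by (intro order_trans[OF norm_triangle_ineq4] add_mono Finite_Cartesian_Product.norm_nth_le)
      ultimately show ?thesis using \<epsilon>(1) by simp
    qed
    ultimately show "norm (W $ a - W $ b) * \<epsilon> \<le> (T + 2 * K * w^4 + 2 * w\<^sup>2) * \<epsilon>\<^sup>2"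
      using Z by (simp add: algebra_simps)
  qed
  then show "W $ a = W $ b" by simp
qed

end

subsection \<open>Rank conditions\<close>

text \<open>The kernel is the orthogonal complement of the row space.\<close>

lemma rank_nullity: "rank A + dim {x. A *v x = 0} = CARD('n)" for A :: "real^'n^'m"
proof -
  have "A *v x = 0 \<longleftrightarrow> (\<forall>r\<in>span (rows A). orthogonal r x)" for x
  proof -
    have "A *v x = 0 \<longleftrightarrow> (\<forall>r\<in>rows A. orthogonal x r)"
      by (auto simp: rows_def row_def vec_eq_iff matrix_vector_mult_def orthogonal_def inner_vec_def mult.commute)
    also have "\<dots> \<longleftrightarrow> (\<forall>r\<in>span (rows A). orthogonal x r)"
      using orthogonal_to_span span_base by blast
    finally show ?thesis by (simp add: orthogonal_commute)
  qed
  then have "{x. A *v x = 0} = {x \<in> UNIV. \<forall>r\<in>span (rows A). orthogonal r x}" by auto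
  then show ?thesis
    using dim_subspace_orthogonal_to_vectors[of "span (rows A)" UNIV]
    by (simp add: row_rank_def)
qed

text \<open>Copies of an orthonormal basis of \<open>S\<close> in the separate coordinates are again
  orthogonal, hence independent.\<close>

lemma dim_tuples:
  fixes S :: "'a::euclidean_space set"
  assumes "subspace S"
  shows "dim {x :: 'a^'k. \<forall>i. x $ i \<in> S} = CARD('k) * dim S"
proof -
  obtain B where B: "B \<subseteq> S" "pairwise orthogonal B" "\<And>x. x \<in> B \<Longrightarrow> norm x = 1"
    "independent B" "card B = dim S" "span B = S"
    using orthonormal_basis_subspace[OF assms] by metis
  define f where "f = (\<lambda>(i :: 'k, b :: 'a). axis i b)"
  define B' where "B' = f ` (UNIV \<times> B)"
  \<comment> \<open>\<open>axis i 0\<close> is the same for all \<open>i\<close>, so injectivity of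
    \<open>f\<close> rests on this.\<close>
  have B0: "0 \<notin> B" using B(3) by force
  have "inj_on f (UNIV \<times> B)"
    using B0 by (auto simp: inj_on_def f_def axis_eq_axis)
  then have card: "card B' = CARD('k) * dim S"
    unfolding B'_def by (simp add: card_image card_cartesian_product B(5))
  have "pairwise orthogonal B'"
    using B(2) by (auto simp: pairwise_def orthogonal_def B'_def f_def inner_axis_axis axis_eq_axis)
  moreover have "0 \<notin> B'" using B0 by (force simp: B'_def f_def axis_eq_0_iff)
  ultimately have indep: "independent B'" by (rule pairwise_orthogonal_independent)
  have lin: "linear (axis i :: 'a \<Rightarrow> 'a^'k)" for i
    by (auto simp: linear_iff vec_eq_iff axis_def)
  have "span B' = {x. \<forall>i. x $ i \<in> S}"
  proof
    have "subspace {x :: 'a^'k. \<forall>i. x $ i \<in> S}"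
      using assms by (auto simp: subspace_def)
    moreover have "B' \<subseteq> {x. \<forall>i. x $ i \<in> S}"
      using B(1) subspace_0[OF assms] by (auto simp: B'_def f_def axis_def)
    ultimately show "span B' \<subseteq> {x. \<forall>i. x $ i \<in> S}" by (rule span_minimal[rotated])
    show "{x. \<forall>i. x $ i \<in> S} \<subseteq> span B'"
    proof
      fix x :: "'a^'k" assume x: "x \<in> {x. \<forall>i. x $ i \<in> S}"
      have "axis i (x $ i) \<in> span B'" for i
      proof -
        have "axis i (x $ i) \<in> axis i ` span B" using x B(6) by auto
        also have "\<dots> = span (axis i ` B)" by (rule linear_span_image[OF lin, symmetric])
        also have "\<dots> \<subseteq> span B'" by (intro span_mono) (auto simp: B'_def f_def)
        finally show ?thesis .
      qed
      then have "(\<Sum>i\<in>UNIV. axis i (x $ i)) \<in> span B'" by (intro span_sum)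
      also have "(\<Sum>i\<in>UNIV. axis i (x $ i)) = x"
        by (auto simp: vec_eq_iff axis_def if_distrib cong: if_cong)
      finally show "x \<in> span B'" .
    qed
  qed
  then show ?thesis using dim_span_eq_card_independent[OF indep] card by simp
qed

section \<open>Stacked tuples and block matrices\<close>

lemma sum_UNIV_pair:
  fixes g :: "'a::finite \<times> 'b::finite \<Rightarrow> 'c::comm_monoid_add"
  shows "(\<Sum>q\<in>UNIV. g q) = (\<Sum>j\<in>UNIV. \<Sum>s\<in>UNIV. g (j, s))"
  by (simp add: sum.cartesian_product flip: UNIV_Times_UNIV)

lemma bounded_linear_vectorize_vstack:
  "bounded_linear (\<lambda>X :: real^'n^'n^'k. vectorize (vstack X))"
  by (auto simp: linear_conv_bounded_linear[symmetric] linear_iff vec_eq_iff vectorize_def vstack_def)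

lemma inj_vectorize_vstack: "inj (\<lambda>X :: real^'n^'n^'k. vectorize (vstack X))"
  by (auto simp: inj_def vec_eq_iff vectorize_def vstack_def)

lemma inner_vectorize_vstack:
  "vectorize (vstack X) \<bullet> vectorize (vstack Y) = X \<bullet> Y" for X Y :: "real^'n^'n^'k"
proof -
  have "vectorize (vstack X) \<bullet> vectorize (vstack Y) = (\<Sum>c\<in>UNIV. \<Sum>i\<in>UNIV. \<Sum>r\<in>UNIV. X $ i $ r $ c * Y $ i $ r $ c)"
    by (simp add: inner_vec_def sum_UNIV_pair vectorize_def vstack_def)
  also have "\<dots> = (\<Sum>i\<in>UNIV. \<Sum>c\<in>UNIV. \<Sum>r\<in>UNIV. X $ i $ r $ c * Y $ i $ r $ c)"
    by (rule sum.swap)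
  also have "\<dots> = X \<bullet> Y"
    unfolding inner_vec_def inner_real_def by (intro sum.cong refl sum.swap)
  finally show ?thesis .
qed

lemma kronecker_mat_1_vectorize:
  "kronecker (mat 1 :: real^'n^'n) L *v vectorize X = vectorize (L ** X)"
  by (simp add: vec_eq_iff matrix_vector_mult_def kronecker_def vectorize_def matrix_matrix_mult_def
      sum_UNIV_pair mat_def if_distrib if_distribR cong: if_cong,
      intro allI, subst sum.swap, simp)

lemma subspace_so_pow: "subspace so_pow"
  using subspace_so by (auto simp: subspace_def so_pow_def)

text \<open>A loop contributes nothing to \<open>lap\<close> but would add its outer product to a
  diagonal block of \<open>ext_laplacian\<close>; irreflexivity makes the two agree.\<close>

locale simple_reference_graph = reference_graph E y
  for E :: "('k::finite \<times> 'k) set" and y :: "'k \<Rightarrow> 'k \<Rightarrow> real^'n::finite" +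
  assumes irreflexive: "(i, i) \<notin> E"
begin

lemma ext_laplacian_vstack: "ext_laplacian E y ** vstack X = vstack (lap X)"
proof -
  let ?a = "adj E"
  define blk where "blk i j = (if i = j then \<Sum>l\<in>UNIV. ?a i l *\<^sub>R outer (y i l) else - (?a i j *\<^sub>R outer (y i j)))" for i j
  have entry: "ext_laplacian E y $ (i, r) $ (j, s) = blk i j $ r $ s" for i r j s
    by (simp add: ext_laplacian_def blk_def)
  have blk_sum: "(\<Sum>j\<in>UNIV. blk i j ** X $ j) = lap X $ i" for i
  proof -
    have "(\<Sum>j\<in>UNIV. blk i j ** X $ j) = blk i i ** X $ i + (\<Sum>j\<in>UNIV - {i}. blk i j ** X $ j)"
      by (rule sum.remove) auto
    also have "(\<Sum>j\<in>UNIV - {i}. blk i j ** X $ j) = (\<Sum>j\<in>UNIV - {i}. - (?a i j *\<^sub>R (outer (y i j) ** X $ j)))"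
      by (intro sum.cong) (auto simp: blk_def matrix_mult_linear)
    also have "\<dots> = (\<Sum>j\<in>UNIV. - (?a i j *\<^sub>R (outer (y i j) ** X $ j)))"
      using irreflexive by (intro sum.mono_neutral_left) (auto simp: adj_def)
    also have "blk i i ** X $ i = (\<Sum>j\<in>UNIV. ?a i j *\<^sub>R (outer (y i j) ** X $ i))"
      by (simp add: blk_def matrix_mult_linear)
    also have "\<dots> + (\<Sum>j\<in>UNIV. - (?a i j *\<^sub>R (outer (y i j) ** X $ j))) =
        (\<Sum>j\<in>UNIV. ?a i j *\<^sub>R (outer (y i j) ** (X $ i - X $ j)))"
      by (simp add: matrix_mult_linear scaleR_diff_right flip: sum.distrib)
    also have "\<dots> = lap X $ i"
      by (simp add: lap_def adj_def if_distrib if_distribR sum.If_cases cong: if_cong)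
    finally show ?thesis .
  qed
  have "(ext_laplacian E y ** vstack X) $ (i, r) $ c = lap X $ i $ r $ c" for i r c
    by (simp add: matrix_matrix_mult_def[of "ext_laplacian E y"] sum_UNIV_pair entry vstack_def flip: blk_sum)
       (simp add: matrix_matrix_mult_def)
  then show ?thesis by (simp add: vec_eq_iff vstack_def)
qed

text \<open>The kernel of the block matrix always contains the \<open>CARD('n)\<close>-dimensional
  space of vectors repeating one block, and the rank leaves no room for more. Each column of a
  stacked tuple in the kernel of \<open>lap\<close> is such a vector.\<close>

lemma kernel_consensus_if_rank:
  assumes rank: "rank (ext_laplacian E y) = CARD('n) * (CARD('k) - 1)" and X: "lap X = 0"
  shows "X $ i = X $ j"
proof -
  let ?L = "ext_laplacian E y"
  define f :: "real^'n \<Rightarrow> real^('k \<times> 'n)" where "f v = (\<chi> p. v $ snd p)" for v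
  have col: "(A ** B) $ p $ c = (A *v (\<chi> q. B $ q $ c)) $ p" for A :: "real^'u^'v" and B :: "real^'w^'u" and p c
    by (simp add: matrix_matrix_mult_def matrix_vector_mult_def)
  have "?L *v f v = 0" for v
  proof -
    define Y :: "real^'n^'n^'k" where "Y = (\<chi> i r c. v $ r)"
    have "lap Y = 0" by (rule lap_consensus) (simp add: Y_def)
    then have "?L ** vstack Y = 0"
      unfolding ext_laplacian_vstack by (simp add: vstack_def vec_eq_iff)
    moreover have "(\<chi> q. vstack Y $ q $ c) = f v" for c :: 'n
      by (simp add: vec_eq_iff Y_def vstack_def f_def)
    ultimately show ?thesis
      using col[of ?L "vstack Y"] by (simp add: vec_eq_iff)
  qed
  then have sub: "range f \<subseteq> {x. ?L *v x = 0}" by auto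
  have lin: "linear f" by (auto simp: linear_iff f_def vec_eq_iff)
  have inj: "inj f" by (auto simp: inj_def f_def vec_eq_iff)
  have "dim (range f) = CARD('n)"
    using dim_image_eq[OF lin, of UNIV] inj by simp
  moreover have "dim {x. ?L *v x = 0} = CARD('n)"
  proof -
    have "CARD('k) = Suc (CARD('k) - 1)" by simp
    then have "CARD('k) * CARD('n) = CARD('n) * (CARD('k) - 1) + CARD('n)"
      by (metis add.commute mult.commute mult_Suc_right)
    then show ?thesis using rank_nullity[of ?L] rank by simp
  qed
  ultimately have eq: "range f = {x. ?L *v x = 0}"
    using sub linear_subspace_image[OF lin subspace_UNIV]
    by (intro subspace_dim_equal) (auto simp: subspace_def matrix_vector_right_distrib matrix_vector_mult_scaleR)
  have "X $ i $ r $ c = X $ j $ r $ c" for r c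
  proof -
    let ?x = "\<chi> q. vstack X $ q $ c"
    have "?L ** vstack X = 0" unfolding ext_laplacian_vstack X by (simp add: vstack_def vec_eq_iff)
    then have "?L *v ?x = 0" using col[of ?L "vstack X"] by (simp add: vec_eq_iff)
    then obtain v where v: "?x = f v" using eq by blast
    have "?x $ (i, r) = ?x $ (j, r)" unfolding v by (simp add: f_def)
    then show ?thesis by (simp add: vstack_def)
  qed
  then show ?thesis by (simp add: vec_eq_iff)
qed

lemma C_o_eq: "C_o E y = {Q \<in> SO_pow. lap Q = 0}"
  by (auto simp: C_o_def lap_eq_0_iff_defect defect_def transpose_linear matrix_vector_mult_diff_rdistrib)

text \<open>\<open>V\<close> parametrises the skew tuples isometrically, so the kernel of the
  compressed matrix is a copy of that of \<open>lap\<close> on \<open>so_pow\<close>. It contains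
  the consensus part; the rank condition says that it is no larger.\<close>

lemma rank_restricted_hessian:
  fixes V :: "real^'d::finite^('n \<times> 'k \<times> 'n)"
  assumes card: "CARD('d) = CARD('k) * CARD('n) * (CARD('n) - 1) div 2"
    and V: "orthonormal_basis_columns V (vec_set (so_pow :: (real^'n^'n^'k) set))"
  shows "rank (transpose V ** kronecker (mat 1 :: real^'n^'n) (ext_laplacian E y) ** V)
      = (CARD('k) - 1) * (CARD('n) * (CARD('n) - 1) div 2) \<longleftrightarrow> consensus_kernel"
proof -
  define J where "J = (\<lambda>X :: real^'n^'n^'k. vectorize (vstack X))"
  define L where "L = kronecker (mat 1 :: real^'n^'n) (ext_laplacian E y)"
  define A where "A = transpose V ** L ** V"
  define N :: "(real^'n^'n^'k) set" where "N = {X \<in> so_pow. lap X = 0}"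
  have linJ: "linear J" and injJ: "inj J"
    using bounded_linear.linear[OF bounded_linear_vectorize_vstack] inj_vectorize_vstack by (auto simp: J_def)
  have LJ: "L *v J X = J (lap X)" for X
    by (simp add: L_def J_def kronecker_mat_1_vectorize ext_laplacian_vstack)
  have "transpose V ** V = mat 1"
    using V by (simp add: orthonormal_basis_columns_def matrix_mult_transpose_dot_column mat_def vec_eq_iff)
  then have VV: "transpose V *v (V *v x) = x" for x by (simp add: matrix_vector_mul_assoc)
  then have injV: "inj ((*v) V)" by (metis injI)
  have rangeV: "range ((*v) V) = J ` so_pow"
  proof -
    have "range ((*v) V) = span (columns V)"
    proof
      show "range ((*v) V) \<subseteq> span (columns V)" using matrix_vector_mult_in_columnspace by blast
      have "columns V \<subseteq> range ((*v) V)" by (auto simp: columns_image_basis)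
      then show "span (columns V) \<subseteq> range ((*v) V)"
        by (intro span_minimal linear_subspace_image) auto
    qed
    then show ?thesis using V by (simp add: orthonormal_basis_columns_def vec_set_def J_def)
  qed
  have dim_J: "dim (J ` S) = dim S" for S
    by (rule dim_image_eq[OF linJ]) (use injJ inj_on_subset in blast)
  \<comment> \<open>A compression can have a larger kernel than the operator. Semidefiniteness
    excludes this: a zero of the quadratic form lies in the kernel of \<open>lap\<close>.\<close>
  have kernel: "A *v x = 0 \<longleftrightarrow> lap X = 0" if "V *v x = J X" for x X
  proof
    assume "A *v x = 0"
    then have "0 = x \<bullet> (transpose V *v (L *v (V *v x)))"
      by (simp add: A_def flip: matrix_vector_mul_assoc)
    also have "\<dots> = (V *v x) \<bullet> (L *v (V *v x))"
      by (metis dot_lmul_matrix inner_commute vector_transpose_matrix transpose_transpose)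
    also have "\<dots> = X \<bullet> lap X" unfolding that LJ by (simp add: J_def inner_vectorize_vstack)
    finally show "lap X = 0" by (simp add: lap_eq_0_iff_inner)
  next
    assume "lap X = 0"
    then have "L *v (V *v x) = 0" unfolding that LJ using linear_0[OF linJ] by simp
    then show "A *v x = 0" by (simp add: A_def flip: matrix_vector_mul_assoc)
  qed
  have "(*v) V ` {x. A *v x = 0} = J ` N"
  proof (intro set_eqI iffI)
    fix z assume "z \<in> (*v) V ` {x. A *v x = 0}"
    then obtain x where x: "A *v x = 0" "z = V *v x" by blast
    moreover obtain X where "X \<in> so_pow" "V *v x = J X" using rangeV by blast
    ultimately show "z \<in> J ` N" using kernel[of x X] by (auto simp: N_def)
  next
    fix z assume "z \<in> J ` N"
    then obtain X where X: "X \<in> so_pow" "lap X = 0" "z = J X" by (auto simp: N_def)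
    then obtain x where "V *v x = J X" using rangeV by (metis imageE imageI)
    then show "z \<in> (*v) V ` {x. A *v x = 0}" using kernel[of x X] X by force
  qed
  then have "dim {x. A *v x = 0} = dim N"
    using dim_image_eq[of "(*v) V" "{x. A *v x = 0}"] injV dim_J[of N]
    by (metis inj_on_subset matrix_vector_mul_linear subset_UNIV)
  then have rankA: "rank A + dim N = CARD('d)" using rank_nullity[of A] by simp
  \<comment> \<open>\<open>V\<close> is injective onto a copy of \<open>so_pow\<close>, so the
    dimension of \<open>so\<close> can be read off the assumed number of columns.\<close>
  have "dim (so_pow :: (real^'n^'n^'k) set) = CARD('d)"
    using dim_image_eq[of "(*v) V" UNIV] injV rangeV dim_J[of so_pow] by simp
  moreover have "dim (so_pow :: (real^'n^'n^'k) set) = CARD('k) * dim (so :: (real^'n^'n) set)"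
    unfolding so_pow_def by (rule dim_tuples[OF subspace_so])
  ultimately have d: "CARD('d) = CARD('k) * dim (so :: (real^'n^'n) set)" by simp
  \<comment> \<open>Evenness lets the integer division move inside the product with
    \<open>CARD('k)\<close>.\<close>
  have "even (CARD('n) * (CARD('n) - 1))" by simp
  then have "CARD('d) = CARD('k) * (CARD('n) * (CARD('n) - 1) div 2)"
    using card by (simp add: div_mult_swap mult.assoc)
  with d have dim_so: "dim (so :: (real^'n^'n) set) = CARD('n) * (CARD('n) - 1) div 2" by simp
  define D where "D = (\<lambda>X :: real^'n^'n. (\<chi> i. X) :: real^'n^'n^'k) ` so"
  have linD: "linear (\<lambda>X :: real^'n^'n. (\<chi> i. X) :: real^'n^'n^'k)"
    using bounded_linear.linear[OF const_bounded_linear] .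
  have "dim D = dim (so :: (real^'n^'n) set)"
    unfolding D_def by (rule dim_image_eq[OF linD]) (auto simp: inj_on_def vec_eq_iff)
  have "D \<subseteq> N"
    by (auto simp: D_def N_def so_pow_def intro!: lap_consensus)
  have "consensus_kernel \<longleftrightarrow> N = D"
  proof
    assume ck: consensus_kernel
    have "X \<in> D" if X: "X \<in> N" for X
    proof -
      \<comment> \<open>\<open>undefined\<close> is an arbitrary index, as all components
        agree.\<close>
      have "X = (\<chi> i. X $ undefined)"
        using ck X unfolding consensus_kernel_def N_def vec_eq_iff[of X] by simp
      moreover have "X $ undefined \<in> so" using X by (simp add: N_def so_pow_def)
      ultimately show ?thesis unfolding D_def by (rule image_eqI)
    qed
    then show "N = D" using \<open>D \<subseteq> N\<close> by blast
  next
    assume "N = D"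
    then have "W \<in> D" if "W \<in> so_pow" "lap W = 0" for W using that unfolding N_def by blast
    then show consensus_kernel by (fastforce simp: consensus_kernel_def D_def)
  qed
  also have "\<dots> \<longleftrightarrow> dim N = dim D"
  proof
    assume "dim N = dim D"
    moreover have "subspace D" unfolding D_def by (rule linear_subspace_image[OF linD subspace_so])
    moreover have "subspace N"
      using subspace_so_pow by (auto simp: N_def subspace_def lap_linear)
    ultimately show "N = D" using subspace_dim_equal[of D N] \<open>D \<subseteq> N\<close> by simp
  qed simp
  also have "\<dots> \<longleftrightarrow> rank A = (CARD('k) - 1) * dim (so :: (real^'n^'n) set)"
  proof -
    have "CARD('k) = Suc (CARD('k) - 1)" by simp
    then have "CARD('d) = (CARD('k) - 1) * dim (so :: (real^'n^'n) set) + dim (so :: (real^'n^'n) set)"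
      unfolding d by (metis add.commute mult_Suc)
    then show ?thesis using rankA \<open>dim D = _\<close> by linarith
  qed
  finally show ?thesis by (simp add: dim_so A_def L_def)
qed

end

theorem theorem2:
  fixes E :: "('k::finite \<times> 'k) set"
    and y :: "'k \<Rightarrow> 'k \<Rightarrow> real^'n::finite"
  assumes k: "CARD('k) > 2" and n: "CARD('n) \<ge> 2"
    and graph: "sym E" "irrefl E"
    and unit: "\<And>i j. (i, j) \<in> E \<Longrightarrow> norm (y i j) = 1"
    and symm: "\<And>i j. (i, j) \<in> E \<Longrightarrow> y i j = y j i"
  shows
    "(rank (ext_laplacian E y) = CARD('n) * (CARD('k) - 1) \<longrightarrow>
        C_o E y = (C_s :: (real^'n^'n^'k) set) \<and>
        locally_exponentially_stable (dynamics E y) SO_pow (C_s :: (real^'n^'n^'k) set)) \<and>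
     (\<forall>V :: real^'d::finite^('n \<times> 'k \<times> 'n).
        CARD('d) = CARD('k) * CARD('n) * (CARD('n) - 1) div 2 \<longrightarrow>
        orthonormal_basis_columns V (vec_set (so_pow :: (real^'n^'n^'k) set)) \<longrightarrow>
        (locally_exponentially_stable (dynamics E y) SO_pow (C_s :: (real^'n^'n^'k) set) \<longleftrightarrow>
         rank (transpose V ** kronecker (mat 1 :: real^'n^'n) (ext_laplacian E y) ** V)
           = (CARD('k) - 1) * (CARD('n) * (CARD('n) - 1) div 2)))"
proof -
  interpret simple_reference_graph E y
    using graph symm by unfold_locales (auto simp: sym_def irrefl_def)
  have stable: "locally_exponentially_stable (dynamics E y) SO_pow C_s \<longleftrightarrow> consensus_kernel"
    using stable_if_consensus_kernel consensus_kernel_if_stable by blast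
  show ?thesis
  proof (intro conjI impI allI)
    assume rank: "rank (ext_laplacian E y) = CARD('n) * (CARD('k) - 1)"
    note consensus = kernel_consensus_if_rank[OF rank]
    show "C_o E y = C_s"
      unfolding C_o_eq C_s_def using consensus by (blast intro: lap_consensus)
    show "locally_exponentially_stable (dynamics E y) SO_pow C_s"
      unfolding stable consensus_kernel_def using consensus by blast
  next
    fix V :: "real^'d::finite^('n \<times> 'k \<times> 'n)"
    assume "CARD('d) = CARD('k) * CARD('n) * (CARD('n) - 1) div 2"
      and "orthonormal_basis_columns V (vec_set (so_pow :: (real^'n^'n^'k) set))"
    then show "locally_exponentially_stable (dynamics E y) SO_pow C_s \<longleftrightarrow>
        rank (transpose V ** kronecker (mat 1 :: real^'n^'n) (ext_laplacian E y) ** V)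
          = (CARD('k) - 1) * (CARD('n) * (CARD('n) - 1) div 2)"
      unfolding stable by (rule rank_restricted_hessian[symmetric])
  qed
qed

end
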